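(* As $N\to\infty$, $$\sigma_F-\sigma_N\sim C_F\,\varphi^{-(N+1)\sigma_F},$$ where $$C_F=\frac{5^{\sigma_F/2}}{(-H'(\sigma_F))(1-\varphi^{-\sigma_F})}=1.77646645548344\ldots.$$
   Context: $F_1=F_2=1$, $F_{n+2}=F_{n+1}+F_n$ are the Fibonacci numbers, $\varphi=(1+\sqrt5)/2$, $Z_F(\sigma)=\sum_{n\ge1}F_n^{-\sigma}$ for $\sigma>0$, and $H(\sigma)=Z_F(\sigma)-4-2\cdot144^{-\sigma}$. $\sigma_F=0.7431\ldots$ is the unique zero of $H$ in $(0.7,0.75)$. For each integer $N\ge12$, $\sigma_N$ is the unique solution in $(1/2,3/4)$ of $\sum_{n=1}^NF_n^{-\sigma_N}=4+2\cdot144^{-\sigma_N}$. The symbol $\sim$ means that the ratio of the two sides tends to $1$. *)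

theory Defs
  imports
    "HOL-Analysis.Analysis"
    "HOL-Library.Landau_Symbols"
    "HOL-Number_Theory.Fib"
begin

definition phi :: real where
  "phi = (1 + sqrt 5) / 2"

(* Only meaningful for \<sigma> > 0, where the series converges. *)
definition Z_F :: "real \<Rightarrow> real" where
  "Z_F \<sigma> = (\<Sum>n. real (fib (Suc n)) powr (- \<sigma>))"

definition H :: "real \<Rightarrow> real" where
  "H \<sigma> = Z_F \<sigma> - 4 - 2 * 144 powr (- \<sigma>)"

definition sigma_F :: real where
  "sigma_F = (THE \<sigma>. 0.7 < \<sigma> \<and> \<sigma> < 0.75 \<and> H \<sigma> = 0)"

(* Only meaningful for N \<ge> 12. *)
definition sigma_N :: "nat \<Rightarrow> real" where
  "sigma_N N = (THE \<sigma>. 1/2 < \<sigma> \<and> \<sigma> < 3/4 \<and>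
     (\<Sum>n=1..N. real (fib n) powr (- \<sigma>)) = 4 + 2 * 144 powr (- \<sigma>))"

definition C_F :: real where
  "C_F = 5 powr (sigma_F / 2) / ((- deriv H sigma_F) * (1 - phi powr (- sigma_F)))"

end

theory Submission
  imports Defs
begin

text \<open>
  Write \<open>H\<^sub>N\<close> for the function obtained from \<^const>\<open>H\<close> by truncating the series after \<open>N\<close> terms,
  so that \<open>H = H\<^sub>N + R\<^sub>N\<close> with \<open>R\<^sub>N(\<sigma>) = \<Sum>\<^bsub>n>N\<^esub> F\<^sub>n\<^bsup>-\<sigma>\<^esup>\<close>. Since \<open>H\<^sub>N(\<sigma>\<^sub>N) = 0\<close> and \<open>H\<^sub>N(\<sigma>\<^sub>F) = -R\<^sub>N(\<sigma>\<^sub>F)\<close>,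
  the mean value theorem gives \<open>(\<sigma>\<^sub>F - \<sigma>\<^sub>N) (-H\<^sub>N'(\<xi>\<^sub>N)) = R\<^sub>N(\<sigma>\<^sub>F)\<close> with \<open>\<xi>\<^sub>N \<rightarrow> \<sigma>\<^sub>F\<close>. The tail is
  almost geometric because \<open>F\<^sub>m\<^sub>+\<^sub>n\<close> agrees with \<open>F\<^sub>m \<phi>\<^sup>n\<close> up to a factor \<open>1 + O(F\<^sub>m\<^sup>-\<^sup>2)\<close>, and
  \<open>H\<^sub>N'\<close> converges to \<open>H'\<close> uniformly.

  The digits of \<open>C\<^sub>F\<close> come from rigorous fixed-point interval arithmetic at a point \<open>\<sigma>\<^sub>0\<close> within \<open>2 \<sqdot> 10\<^sup>-\<^sup>1\<^sup>8\<close>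
  of \<open>\<sigma>\<^sub>F\<close>: the terms with \<open>n < 42\<close> are enclosed one by one and the rest is the almost geometric tail.
\<close>

section \<open>Interval arithmetic for powers of Fibonacci numbers\<close>

type_synonym ivl = "int \<times> int"

text \<open>An interval is a pair of non-negative multiples of \<open>2\<^sup>-\<^sup>6\<^sup>8\<close>; \<open>ivl_unit = 2\<^sup>6\<^sup>8\<close> represents \<open>1\<close>.\<close>

definition ivl_unit :: int where "ivl_unit = 295147905179352825856"

definition encl :: "ivl \<Rightarrow> real \<Rightarrow> bool" where
  "encl i x \<longleftrightarrow>
    0 \<le> fst i \<and> real_of_int (fst i) \<le> real_of_int ivl_unit * x \<and> real_of_int ivl_unit * x \<le> real_of_int (snd i)"

definition iadd :: "ivl \<Rightarrow> ivl \<Rightarrow> ivl" where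
  "iadd i j = (fst i + fst j, snd i + snd j)"

text \<open>Clamping the lower end at 0 keeps it non-negative, as \<open>encl\<close> demands; this
  is sound for non-negative differences only.\<close>

definition isub :: "ivl \<Rightarrow> ivl \<Rightarrow> ivl" where
  "isub i j = (max 0 (fst i - snd j), snd i - fst j)"

text \<open>\<open>div\<close> rounds down; adding 1 to the upper end, even when the quotient is
  exact, rounds it safely up.\<close>

definition imul :: "ivl \<Rightarrow> ivl \<Rightarrow> ivl" where
  "imul i j = (fst i * fst j div ivl_unit, snd i * snd j div ivl_unit + 1)"

definition idiv :: "ivl \<Rightarrow> int \<Rightarrow> ivl" where
  "idiv i k = (fst i div k, snd i div k + 1)"

text \<open>Horner scheme, innermost term first, for d * artanh(1/d) in powers of 1/q with q = d^2.
  The seed \<open>r\<close> encloses the rescaled remainder, so truncation error is carried along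
  with the rounding errors.\<close>

primrec iartanh :: "nat \<Rightarrow> int \<Rightarrow> ivl \<Rightarrow> ivl" where
  "iartanh 0 q r = r"
| "iartanh (Suc j) q r = iartanh j q (iadd (idiv (ivl_unit, ivl_unit) (2 * int j + 1)) (idiv r q))"

definition iln :: "nat \<Rightarrow> int \<Rightarrow> ivl" where
  "iln k d = (let r = idiv (iartanh k (d * d) (0, 2 * ivl_unit)) d in iadd r r)"

text \<open>The nested form 1 - t/1 * (1 - t/2 * (...)) keeps every intermediate value non-negative
  even for exp(-t), which the non-negative intervals require. Again \<open>r\<close> is seeded with
  the remainder.\<close>

primrec iexp :: "bool \<Rightarrow> nat \<Rightarrow> ivl \<Rightarrow> ivl \<Rightarrow> ivl" where
  "iexp neg 0 t r = r"
| "iexp neg (Suc k) t r = iexp neg k t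
     ((if neg then isub else iadd) (ivl_unit, ivl_unit) (idiv (imul t r) (int k + 1)))"

section \<open>Soundness of the interval operations and of the two series\<close>

lemma ivl_unit_pos: "0 < ivl_unit" and real_ivl_unit_pos: "0 < real_of_int ivl_unit"
  by (simp_all add: ivl_unit_def)

lemma encl_nonneg: "0 \<le> x" if "encl i x"
  using that ivl_unit_pos by (smt (verit) encl_def of_int_0_le_iff of_int_pos zero_le_mult_iff)

lemma int_div_le: "0 < k \<Longrightarrow> real_of_int (a div k) \<le> real_of_int a / real_of_int k"
  by (metis floor_divide_of_int_eq of_int_floor_le)

lemma int_le_div_plus_1: "0 < k \<Longrightarrow> real_of_int a / real_of_int k \<le> real_of_int (a div k + 1)"
  by (metis floor_divide_of_int_eq less_eq_real_def linorder_not_less of_int_1 of_int_add real_of_int_floor_add_one_ge)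

lemma encl_one: "encl (ivl_unit, ivl_unit) 1"
  by (simp add: encl_def ivl_unit_def)

lemma encl_zero: "encl (0, 0) 0"
  by (simp add: encl_def)

lemma encl_iadd: "encl i x \<Longrightarrow> encl j y \<Longrightarrow> encl (iadd i j) (x + y)"
  by (auto simp: encl_def iadd_def distrib_left)

lemma encl_isub: "encl i x \<Longrightarrow> encl j y \<Longrightarrow> y \<le> x \<Longrightarrow> encl (isub i j) (x - y)"
  using real_ivl_unit_pos by (auto simp: encl_def isub_def right_diff_distrib max_def)

lemma encl_idiv:
  assumes "encl i x" "0 < k"
  shows "encl (idiv i k) (x / real_of_int k)"
proof -
  have "real_of_int (fst i) / k \<le> ivl_unit * x / k" "ivl_unit * x / k \<le> real_of_int (snd i) / k"
    using assms by (auto simp: encl_def intro!: divide_right_mono)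
  then show ?thesis
    using assms int_div_le[of k "fst i"] int_le_div_plus_1[of k "snd i"]
    by (auto simp: encl_def idiv_def pos_imp_zdiv_nonneg_iff)
qed

lemma encl_imul:
  assumes "encl i x" "encl j y"
  shows "encl (imul i j) (x * y)"
proof -
  have nonneg: "0 \<le> x" "0 \<le> y"
    using assms encl_nonneg by auto
  have "real_of_int (fst i * fst j) \<le> (ivl_unit * x) * (ivl_unit * y)"
    using assms unfolding of_int_mult encl_def by (intro mult_mono) auto
  moreover have "(ivl_unit * x) * (ivl_unit * y) \<le> real_of_int (snd i * snd j)"
    using assms nonneg real_ivl_unit_pos unfolding of_int_mult encl_def by (intro mult_mono) auto
  ultimately have "real_of_int (fst i * fst j) / ivl_unit \<le> ivl_unit * (x * y)"
    "ivl_unit * (x * y) \<le> real_of_int (snd i * snd j) / ivl_unit"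
    using real_ivl_unit_pos by (auto simp: field_simps)
  moreover have "0 \<le> fst i * fst j div ivl_unit"
    using assms ivl_unit_pos by (auto simp: encl_def pos_imp_zdiv_nonneg_iff)
  ultimately show ?thesis
    using int_div_le[OF ivl_unit_pos, of "fst i * fst j"] int_le_div_plus_1[OF ivl_unit_pos, of "snd i * snd j"]
    unfolding encl_def imul_def fst_conv snd_conv by linarith
qed

lemma encl_iartanh:
  assumes "encl r \<theta>" "0 < q"
  shows "encl (iartanh j q r) ((\<Sum>i<j. (1 / q) ^ i / real (2 * i + 1)) + (1 / q) ^ j * \<theta>)"
  using assms(1)
proof (induction j arbitrary: r \<theta>)
  case (Suc j)
  have "encl (iadd (idiv (ivl_unit, ivl_unit) (2 * int j + 1)) (idiv r q)) (1 / real_of_int (2 * int j + 1) + \<theta> / q)"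
    using assms(2) Suc.prems by (intro encl_iadd encl_idiv encl_one) auto
  from Suc.IH[OF this] show ?case
    by (simp add: algebra_simps)
qed simp

text \<open>With x = (d + 1)/(d - 1) one has (x - 1)/(x + 1) = 1/d, so ln x = 2 artanh(1/d), and the
  remainder of that series is known explicitly.\<close>

lemma encl_iln:
  fixes d :: int
  assumes "3 \<le> d"
  shows "encl (iln k d) (ln ((real_of_int d + 1) / (real_of_int d - 1)))"
proof -
  define y w where "y = 1 / real_of_int d" and "w = 1 / real_of_int (d * d)"
  define x where "x = (real_of_int d + 1) / (real_of_int d - 1)"
  have d: "real_of_int d \<ge> 3"
    using assms by simp
  have x: "x > 1"
    using d by (simp add: x_def)
  have y: "(x - 1) / (x + 1) = y"
    using d by (simp add: x_def y_def field_simps)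
  have w: "y\<^sup>2 = w"
    by (simp add: y_def w_def power2_eq_square)
  then have wk: "y ^ (2 * k) = w ^ k"
    by (simp add: power_mult)
  define A where "A = (\<Sum>i<k. w ^ i / real (2 * i + 1))"
  have sum: "(\<Sum>i<k. 2 * y ^ (2 * i + 1) / of_nat (2 * i + 1)) = 2 * y * A"
    unfolding A_def sum_distrib_left w[symmetric]
    by (intro sum.cong) (auto simp: power_mult)
  have wpos: "0 < w" and "w \<le> 1 / 9" and ypos: "0 < y"
    using d mult_mono[of 3 "real_of_int d" 3 "real_of_int d"] by (auto simp: w_def y_def field_simps)
  \<comment> \<open>The exact remainder, scaled so that the Horner scheme seeded with it returns ln
    x / (2 y) exactly. What follows shows that it lies in [0, 2], the seed interval of
    \<open>iln\<close>.\<close>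
  define \<theta> where "\<theta> = (ln x / (2 * y) - A) / w ^ k"
  note bnd = ln_approx_bounds[OF x, of k, unfolded y sum]
  have "2 * y * A \<le> ln x"
    using bnd by simp
  then have "A \<le> ln x / (2 * y)"
    using ypos by (simp add: field_simps)
  then have "0 \<le> \<theta>"
    using wpos by (simp add: \<theta>_def)
  have "ln x \<le> 2 * y * A + 2 * (y * w ^ k / (1 - w) / real (2 * k + 1))"
    using bnd by (simp add: w wk mult_ac flip: wk)
  then have "ln x / (2 * y) - A \<le> w ^ k / (1 - w) / real (2 * k + 1)"
    using ypos by (simp add: field_simps)
  also have "\<dots> \<le> w ^ k / (1 - w)"
    using wpos \<open>w \<le> 1 / 9\<close> divide_left_mono[of 1 "real (2 * k + 1)" "w ^ k / (1 - w)"] by simp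
  also have "\<dots> \<le> w ^ k * 2"
    using wpos \<open>w \<le> 1 / 9\<close> by (simp add: field_simps)
  finally have "\<theta> \<le> 2"
    using wpos by (simp add: \<theta>_def field_simps)
  have "encl (0, 2 * ivl_unit) \<theta>"
    using \<open>0 \<le> \<theta>\<close> \<open>\<theta> \<le> 2\<close> real_ivl_unit_pos by (simp add: encl_def)
  moreover have "0 < d * d"
    using assms by simp
  ultimately have "encl (iartanh k (d * d) (0, 2 * ivl_unit)) (A + w ^ k * \<theta>)"
    unfolding A_def w_def by (rule encl_iartanh)
  moreover have "A + w ^ k * \<theta> = ln x / (2 * y)"
    using wpos by (simp add: \<theta>_def)
  ultimately have "encl (idiv (iartanh k (d * d) (0, 2 * ivl_unit)) d) (ln x / (2 * y) / real_of_int d)"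
    using assms by (intro encl_idiv) auto
  from encl_iadd[OF this this] show ?thesis
    using d by (simp add: iln_def Let_def y_def x_def)
qed

lemma encl_iexp:
  fixes \<tau> \<theta> :: real
  assumes "encl t \<tau>" "\<tau> \<le> 1" "encl r \<theta>" "neg \<Longrightarrow> \<tau> * \<theta> \<le> 1"
  defines "x \<equiv> if neg then - \<tau> else \<tau>"
  shows "encl (iexp neg k t r) ((\<Sum>m<k. x ^ m / fact m) + \<theta> / fact k * x ^ k)"
  using assms(3,4)
proof (induction k arbitrary: r \<theta>)
  case (Suc k)
  define p where "p = \<tau> * \<theta> / real_of_int (int k + 1)"
  have p: "encl (idiv (imul t r) (int k + 1)) p"
    unfolding p_def using Suc.prems assms(1) by (intro encl_idiv encl_imul) auto
  have "0 \<le> p"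
    using p by (rule encl_nonneg)
  have "0 \<le> \<tau>"
    using assms(1) by (rule encl_nonneg)
  have p1: "p \<le> 1" if neg
    using Suc.prems(2)[OF that] by (simp add: p_def field_simps)
  have e: "encl ((if neg then isub else iadd) (ivl_unit, ivl_unit) (idiv (imul t r) (int k + 1)))
      (if neg then 1 - p else 1 + p)"
    using p p1 by (auto intro: encl_isub encl_iadd encl_one)
  \<comment> \<open>The side condition reproduces itself for the new seed, so no subtraction in the
    scheme goes below 0.\<close>
  have "neg \<Longrightarrow> \<tau> * (if neg then 1 - p else 1 + p) \<le> 1"
    using \<open>0 \<le> p\<close> p1 \<open>0 \<le> \<tau>\<close> \<open>\<tau> \<le> 1\<close> mult_mono[of \<tau> 1 "1 - p" 1] by simp
  from Suc.IH[OF e this] have "encl (iexp neg (Suc k) t r)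
      ((\<Sum>m<k. x ^ m / fact m) + (if neg then 1 - p else 1 + p) / fact k * x ^ k)"
    by simp
  moreover have "(if neg then 1 - p else 1 + p) / fact k * x ^ k
      = x ^ k / fact k + \<theta> / fact (Suc k) * x ^ Suc k"
    by (auto simp: p_def x_def divide_simps; simp add: algebra_simps)
  ultimately show ?case
    by (simp add: add.assoc)
qed simp

text \<open>The Lagrange remainder involves exp u for an unknown u with |u| <= 0.52. Since exp u <=
  1.7904, the seed [0, 2] covers it, and 0.52 * 1.7904 <= 1 gives the side condition of
  \<open>encl_iexp\<close>.\<close>

lemma encl_iexp_exp:
  assumes "encl t \<tau>" "\<tau> \<le> 0.52"
  shows "encl (iexp neg k t (0, 2 * ivl_unit)) (exp (if neg then - \<tau> else \<tau>))"
proof -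
  define x where "x = (if neg then - \<tau> else \<tau>)"
  have "0 \<le> \<tau>"
    using assms(1) by (rule encl_nonneg)
  obtain u where u: "\<bar>u\<bar> \<le> \<bar>x\<bar>" "exp x = (\<Sum>m<k. x ^ m / fact m) + exp u / fact k * x ^ k"
    using Maclaurin_exp_le[of x k] by blast
  have "\<bar>u\<bar> \<le> 0.52"
    using u(1) assms(2) \<open>0 \<le> \<tau>\<close> by (auto simp: x_def split: if_splits)
  then have "exp u \<le> exp 0.52"
    by simp
  also have "\<dots> \<le> 1 + 0.52 + 0.52\<^sup>2"
    by (rule exp_bound) auto
  finally have e: "exp u \<le> 1.7904"
    by (simp add: power2_eq_square)
  have "\<tau> * exp u \<le> 0.52 * 1.7904"
    using e assms(2) \<open>0 \<le> \<tau>\<close> by (intro mult_mono) auto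
  moreover have "encl (0, 2 * ivl_unit) (exp u)"
    using e real_ivl_unit_pos by (simp add: encl_def)
  ultimately have "encl (iexp neg k t (0, 2 * ivl_unit)) ((\<Sum>m<k. x ^ m / fact m) + exp u / fact k * x ^ k)"
    unfolding x_def using assms by (intro encl_iexp) auto
  then show ?thesis
    using u(2) by (simp add: x_def)
qed

text \<open>
  By Cassini's identity the ratios \<open>\<rho>\<^sub>n = F\<^sub>n\<^sub>+\<^sub>1 / F\<^sub>n\<close> satisfy \<open>\<rho>\<^sub>n\<^sub>+\<^sub>1 / \<rho>\<^sub>n = 1 \<plusminus> 1 / F\<^sub>n\<^sub>+\<^sub>1\<^sup>2\<close>, so each step only needs the logarithm and
  exponential of a rapidly decreasing quantity. The flag in a
  state is the sign, and \<open>44 / (n + 1) + 1\<close> series terms exhaust the precision.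
\<close>

type_synonym state = "nat \<times> int \<times> int \<times> bool \<times> ivl \<times> ivl \<times> ivl \<times> ivl \<times> ivl \<times> ivl"

text \<open>\<open>v\<close> encloses the absolute value of the logarithm of the quotient of the
  next ratio by the current one, and \<open>g\<close> that quotient to the power -s.
  \<open>S\<close> and \<open>T\<close> receive the term of the old index.\<close>

fun fib_update :: "ivl \<Rightarrow> ivl \<Rightarrow> state \<Rightarrow> state" where
  "fib_update v g (n, a, b, pos, L, M, P, R, S, T) =
     (Suc n, b, a + b, \<not> pos, iadd L M, (if pos then iadd else isub) M v,
      imul P R, imul R g, iadd S P, iadd T (imul L P))"

fun fib_step_exp :: "ivl \<Rightarrow> ivl \<Rightarrow> state \<Rightarrow> state" where
  "fib_step_exp s v (n, a, b, pos, st) =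
     fib_update v (iexp pos (44 div Suc n + 1) (imul s v) (0, 2 * ivl_unit)) (n, a, b, pos, st)"

fun fib_step :: "ivl \<Rightarrow> state \<Rightarrow> state" where
  "fib_step s (n, a, b, pos, st) =
     fib_step_exp s (iln (44 div Suc n + 1) (2 * b * b + (if pos then 1 else - 1)))
       (n, a, b, pos, st)"

primrec fib_steps :: "nat \<Rightarrow> ivl \<Rightarrow> state \<Rightarrow> state" where
  "fib_steps 0 s st = st"
| "fib_steps (Suc k) s st = fib_steps k s (fib_step s st)"

fun encl_state :: "real \<Rightarrow> state \<Rightarrow> bool" where
  "encl_state s (n, a, b, pos, L, M, P, R, S, T) \<longleftrightarrow>
     0 < n \<and> a = int (fib n) \<and> b = int (fib (Suc n)) \<and>
     b * b + (if pos then 1 else - 1) = a * (a + b) \<and>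
     encl L (ln (fib n)) \<and> encl M (ln (fib (Suc n) / fib n)) \<and>
     encl P (fib n powr - s) \<and> encl R ((fib (Suc n) / fib n) powr - s) \<and>
     encl S (\<Sum>k=1..<n. fib k powr - s) \<and>
     encl T (\<Sum>k=1..<n. ln (fib k) * fib k powr - s)"

text \<open>For d = 2 b^2 + 1 or 2 b^2 - 1, the number (d + 1)/(d - 1) is the quotient of two
  consecutive ratios, taken in the direction that exceeds 1. Its logarithm is thus positive, and the
  flag decides whether it is added or subtracted.\<close>

lemma encl_state_step:
  assumes snd: "encl_state s st" and s: "encl si s" "s \<le> 0.7432"
  shows "encl_state s (fib_step si st)"
proof -
  obtain n a b pos L M P R S T where st: "st = (n, a, b, pos, L, M, P, R, S, T)"
    by (metis surj_pair)
  define A B where "A = real (fib n)" and "B = real (fib (Suc n))"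
  note h = snd[unfolded st encl_state.simps]
  have n: "0 < n" and a: "a = int (fib n)" and b: "b = int (fib (Suc n))"
    and ab: "b * b + (if pos then 1 else - 1) = a * (a + b)"
    and LM: "encl L (ln A)" "encl M (ln (B / A))"
    and PR: "encl P (A powr - s)" "encl R ((B / A) powr - s)"
    and S: "encl S (\<Sum>k=1..<n. fib k powr - s)"
    and T: "encl T (\<Sum>k=1..<n. ln (fib k) * fib k powr - s)"
    using h by (auto simp: A_def B_def)
  have a1: "1 \<le> a" and b1: "1 \<le> b"
    using n fib_neq_0_nat[of n] fib_neq_0_nat[of "Suc n"] by (auto simp: a b simp del: fib.simps)
  \<comment> \<open>Excludes d = 1, where (d + 1)/(d - 1) has a zero denominator;
    \<open>encl_iln\<close> needs d >= 3.\<close>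
  have "b \<noteq> 1" if "\<not> pos"
  proof
    assume "b = 1"
    then have "a * (a + 1) = 0"
      using ab that by simp
    then show False
      using a1 by auto
  qed
  then have b2: "2 \<le> b" if "\<not> pos"
    using b1 that by force
  define d where "d = 2 * b * b + (if pos then 1 else - 1)"
  have d3: "3 \<le> d"
    using b1 b2 mult_mono[of 1 b 1 b] mult_mono[of 2 b 2 b] by (auto simp: d_def)
  have AB: "1 \<le> A" "1 \<le> B"
    using a1 b1 by (simp_all add: A_def B_def a b)
  have "real_of_int (b * b + (if pos then 1 else - 1)) = real_of_int (a * (a + b))"
    using ab by simp
  then have AB2: "B * B + (if pos then 1 else - 1) = A * (A + B)"
    by (auto simp: A_def B_def a b simp del: fib.simps split: if_splits)
  define C where "C = A + B"
  have C: "C = real (fib (Suc (Suc n)))"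
    by (simp add: A_def B_def C_def)
  have "1 \<le> C"
    using AB by (simp add: C_def)
  define x where "x = (real_of_int d + 1) / (real_of_int d - 1)"
  have d: "real_of_int d = 2 * (B * B) + (if pos then 1 else - 1)"
    by (simp add: d_def B_def b del: fib.simps)
  have x: "x = (if pos then (C / B) / (B / A) else (B / A) / (C / B))"
  proof (cases pos)
    case True
    have "A * C = B * B + 1"
      using AB2 True by (simp add: C_def)
    then show ?thesis
      using True AB \<open>1 \<le> C\<close> by (simp add: x_def d divide_simps mult_ac)
  next
    case False
    have "A * C = B * B - 1"
      using AB2 False by (simp add: C_def)
    have "x = 2 * (B * B) / (2 * (B * B - 1))"
      using False by (simp add: x_def d)
    also have "\<dots> = B * B / (B * B - 1)"
      by (rule mult_divide_mult_cancel_left) simp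
    also have "\<dots> = (B / A) / (C / B)"
      using \<open>A * C = B * B - 1\<close> by (simp add: mult_ac)
    finally show ?thesis
      using False by simp
  qed
  have pos_ratio: "0 < B / A" "0 < C / B"
    using AB \<open>1 \<le> C\<close> by simp_all
  have lnx: "ln x = (if pos then ln (C / B) - ln (B / A) else ln (B / A) - ln (C / B))"
    using ln_divide_pos[OF pos_ratio(2,1)] ln_divide_pos[OF pos_ratio]
    by (cases pos) (simp_all only: x if_True if_False)
  have x2: "x \<le> 2" "1 < x"
    using d3 by (simp_all add: x_def field_simps)
  have "ln x \<le> ln 2"
    using x2 by simp
  have lnx_le: "0 \<le> ln x" "ln x \<le> 25 / 36"
    using x2 order.trans[OF \<open>ln x \<le> ln 2\<close> ln2_le_25_over_36] by auto
  define v where "v = iln (44 div Suc n + 1) d"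
  have v: "encl v (ln x)"
    unfolding v_def x_def using d3 by (rule encl_iln)
  have s0: "0 \<le> s"
    using s(1) by (rule encl_nonneg)
  have sv: "encl (imul si v) (s * ln x)"
    using s(1) v by (rule encl_imul)
  \<comment> \<open>d >= 3 gives x <= 2, so ln x <= ln 2 <= 25/36; this is where the bound 0.52 of
    \<open>encl_iexp_exp\<close> comes from.\<close>
  have "s * ln x \<le> 0.7432 * (25 / 36)"
    using s s0 lnx_le by (intro mult_mono) auto
  then have svle: "s * ln x \<le> 0.52"
    by simp
  define g where "g = iexp pos (44 div Suc n + 1) (imul si v) (0, 2 * ivl_unit)"
  have "encl g (exp (if pos then - (s * ln x) else s * ln x))"
    unfolding g_def by (rule encl_iexp_exp[OF sv svle])
  also have "exp (if pos then - (s * ln x) else s * ln x) = exp (- s * (ln (C / B) - ln (B / A)))"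
    by (simp add: lnx algebra_simps)
  finally have g: "encl g (exp (- s * (ln (C / B) - ln (B / A))))" .
  have "encl (iadd L M) (ln B)"
    using encl_iadd[OF LM] AB by (simp add: ln_div)
  moreover have "encl ((if pos then iadd else isub) M v) (ln (C / B))"
  proof (cases pos)
    case True
    then show ?thesis
      using encl_iadd[OF LM(2) v] by (simp add: lnx)
  next
    case False
    have "1 \<le> C / B"
      using AB by (simp add: C_def)
    then have "ln x \<le> ln (B / A)"
      using False by (simp add: lnx)
    then show ?thesis
      using encl_isub[OF LM(2) v] False by (simp add: lnx)
  qed
  moreover have "encl (imul P R) (B powr - s)"
    using encl_imul[OF PR] AB by (simp flip: powr_mult)
  moreover have "u powr - s * exp (- s * (ln w - ln u)) = w powr - s" if "0 < u" "0 < w" for u w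
    using that by (simp add: powr_def algebra_simps flip: exp_add)
  then have "encl (imul R g) ((C / B) powr - s)"
    using encl_imul[OF PR(2) g] pos_ratio by metis
  moreover have "encl (iadd S P) (\<Sum>k=1..<Suc n. fib k powr - s)"
    using encl_iadd[OF S PR(1)] n by (simp add: A_def)
  moreover have "encl (iadd T (imul L P)) (\<Sum>k=1..<Suc n. ln (fib k) * fib k powr - s)"
    using encl_iadd[OF T encl_imul[OF LM(1) PR(1)]] n by (simp add: A_def)
  moreover have "(a + b) * (a + b) + (if \<not> pos then 1 else - 1) = b * (b + (a + b))"
    using ab by (auto simp: algebra_simps)
  moreover have "fib_step si st = (Suc n, b, a + b, \<not> pos, iadd L M, (if pos then iadd else isub) M v,
      imul P R, imul R g, iadd S P, iadd T (imul L P))"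
    by (simp only: st fib_step.simps fib_step_exp.simps fib_update.simps v_def g_def d_def)
  moreover have "a + b = int (fib (Suc (Suc n)))"
    by (simp add: a b)
  ultimately show ?thesis
    using b by (simp only: encl_state.simps C[symmetric] B_def[symmetric]) simp
qed

section \<open>The function \<open>H\<close> and its truncations\<close>

lemma phi_gt_1: "1 < phi" and phi_le: "phi \<le> 13 / 8"
proof -
  have "sqrt 5 \<le> 9 / 4" "1 < sqrt 5"
    by (rule real_le_lsqrt) (auto simp: power2_eq_square)
  then show "1 < phi" "phi \<le> 13 / 8"
    by (simp_all add: phi_def)
qed

lemma phi_square: "phi * phi = phi + 1"
  by (simp add: phi_def algebra_simps)

lemma phi_power_Suc_Suc: "phi ^ Suc (Suc n) = phi ^ n * (phi + 1)"
  by (simp add: mult_ac flip: phi_square)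

lemma phi_psi: "(1 - phi) * phi = - 1"
  using phi_square by (simp add: algebra_simps)

lemma fib_Suc_phi: "real (fib (Suc m)) = phi * fib m + (1 - phi) ^ m"
proof (induction m)
  case (Suc m)
  have "real (fib (Suc (Suc m))) = (phi + 1) * fib m + (1 - phi) ^ m"
    using Suc.IH by (simp add: algebra_simps)
  also have "\<dots> = phi * (phi * fib m + (1 - phi) ^ m) + (1 - phi) ^ Suc m"
    by (simp add: algebra_simps flip: phi_square)
  finally show ?case
    using Suc.IH by simp
qed simp

text \<open>Both sides satisfy the Fibonacci recurrence in n, because \<open>phi\<close> and its
  conjugate \<open>1 - phi\<close> differ by a multiple of sqrt 5 and the values at n = 0 and n = 1
  agree.\<close>

lemma fib_add_phi: "real (fib (m + n)) = phi ^ n * fib m + (1 - phi) ^ m * fib n"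
proof (induction n rule: fib.induct)
  case 2
  then show ?case
    using fib_Suc_phi[of m] by simp
next
  case (3 n)
  have "real (fib (m + Suc (Suc n))) = real (fib (m + Suc n)) + real (fib (m + n))"
    by simp
  also have "\<dots> = phi ^ n * (phi + 1) * fib m + (1 - phi) ^ m * (fib (Suc n) + fib n)"
    unfolding 3 by (simp add: algebra_simps)
  finally show ?case
    by (simp only: phi_power_Suc_Suc fib.simps of_nat_add)
qed simp

lemma fib_le_phi_power: "real (fib n) \<le> phi ^ n"
proof (induction n rule: fib.induct)
  case (3 n)
  then have "real (fib (Suc (Suc n))) \<le> phi ^ n * (phi + 1)"
    by (simp add: algebra_simps)
  then show ?case
    by (simp add: mult_ac flip: phi_square)
qed (use phi_gt_1 in auto)

lemma phi_power_le_fib: "phi ^ n \<le> phi * fib (Suc n)"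
proof (induction n rule: fib.induct)
  case (3 n)
  then have "phi ^ n * (phi + 1) \<le> phi * fib (Suc (Suc (Suc n)))"
    by (simp add: algebra_simps)
  then show ?case
    by (simp add: mult_ac flip: phi_square)
qed (use phi_gt_1 in auto)

lemma fib_ge_1: "0 < n \<Longrightarrow> 1 \<le> real (fib n)"
  using fib_neq_0_nat[of n] by simp

lemma ln_fib_nonneg: "0 \<le> ln (real (fib n))"
  using fib_ge_1[of n] by (cases "n = 0") auto

text \<open>By \<open>fib_add_phi\<close> the error is (1 - phi)^m * F_n / (phi^n * F_m). One factor
  1/F_m is explicit, the other comes from |1 - phi|^m = phi^(-m) <= 1/F_m, and F_n <= phi^n.\<close>

lemma fib_ratio_bound:
  assumes "0 < m"
  shows "\<bar>fib (m + n) / (fib m * phi ^ n) - 1\<bar> \<le> 1 / real (fib m) ^ 2"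
proof -
  have F: "1 \<le> real (fib m)"
    using assms by (rule fib_ge_1)
  have phin: "0 < phi ^ n" "0 < phi ^ m"
    using phi_gt_1 by simp_all
  have "(1 - phi) ^ m * phi ^ m = (- 1) ^ m"
    by (simp add: phi_psi flip: power_mult_distrib)
  then have "\<bar>(1 - phi) ^ m\<bar> * phi ^ m = 1"
    using phin by (metis abs_mult abs_of_pos abs_neg_one power_abs power_one)
  then have psi: "\<bar>(1 - phi) ^ m\<bar> = 1 / phi ^ m"
    using phin phi_gt_1 by (simp add: eq_divide_eq)
  also have "\<dots> \<le> 1 / fib m"
    using fib_le_phi_power[of m] F by (intro divide_left_mono) auto
  finally have psi_le: "\<bar>(1 - phi) ^ m\<bar> \<le> 1 / fib m" .
  have "fib (m + n) / (fib m * phi ^ n) - 1 = (1 - phi) ^ m * (fib n / phi ^ n) / fib m"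
    using F phi_gt_1 by (simp add: fib_add_phi add_divide_distrib)
  then have "\<bar>fib (m + n) / (fib m * phi ^ n) - 1\<bar> = \<bar>(1 - phi) ^ m\<bar> * (fib n / phi ^ n) / fib m"
    using phin by (simp add: abs_mult)
  also have "\<dots> \<le> 1 / fib m * 1 / fib m"
    using psi_le F fib_le_phi_power[of n] phin by (intro divide_right_mono mult_mono) auto
  finally show ?thesis
    by (simp add: power2_eq_square)
qed

lemma fib_powr_le:
  assumes "0 \<le> a"
  shows "real (fib (Suc n)) powr - a \<le> phi powr a * (phi powr - a) ^ n"
proof -
  have p: "0 < phi ^ n / phi"
    using phi_gt_1 by simp
  have "phi ^ n / phi \<le> fib (Suc n)"
    using phi_power_le_fib[of n] phi_gt_1 by (simp add: field_simps)
  then have "real (fib (Suc n)) powr - a \<le> (phi ^ n / phi) powr - a"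
    using p assms by (intro powr_mono2') auto
  also have "\<dots> = phi powr a * (phi powr - a) ^ n"
  proof -
    have "phi ^ n / phi = phi powr (real n - 1)"
      using phi_gt_1 by (simp add: powr_diff powr_realpow)
    moreover have "(phi powr - a) ^ n = phi powr (real n * - a)"
      using phi_gt_1 by (intro powr_power) auto
    ultimately show ?thesis
      by (simp add: powr_powr algebra_simps flip: powr_add)
  qed
  finally show ?thesis .
qed

section \<open>Summability and majorants uniform in the exponent\<close>

lemma phi_powr_less_1: "0 < a \<Longrightarrow> phi powr - a < 1"
  using powr_less_mono[of "- a" 0 phi] phi_gt_1 by simp

lemma summable_fib_powr:
  assumes "0 < a"
  shows "summable (\<lambda>n. real (fib (Suc n)) powr - a)"
proof (rule summable_comparison_test)
  show "summable (\<lambda>n. phi powr a * (phi powr - a) ^ n)"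
    using phi_powr_less_1[OF assms] by (intro summable_mult summable_geometric) auto
qed (use fib_powr_le assms in auto)

text \<open>Comparison with a geometric series of ratio at most 9/10 and first term at most 12/10.
  Fourth powers reduce both bounds to \<open>phi_le\<close>.\<close>

lemma suminf_fib_powr_quarter_le: "(\<Sum>n. real (fib (Suc n)) powr - (1 / 4)) \<le> 12"
proof -
  define r where "r = phi powr - (1 / 4)"
  have r: "0 < r" "r < 1"
    using phi_powr_less_1[of "1 / 4"] phi_gt_1 by (auto simp: r_def)
  have "r ^ 4 = phi powr (real 4 * - (1 / 4))"
    unfolding r_def using phi_gt_1 by (intro powr_power) simp
  then have "r ^ 4 = 1 / phi"
    using phi_gt_1 by (simp add: powr_minus_divide)
  also have "\<dots> = phi - 1"
    using phi_square phi_gt_1 by (simp add: field_simps)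
  finally have r4: "r ^ 4 = phi - 1" .
  have r9: "r \<le> 9 / 10"
  proof (rule power_le_imp_le_base[of _ 3])
    show "r ^ Suc 3 \<le> (9 / 10) ^ Suc 3"
      using r4 phi_le by (simp add: eval_nat_numeral)
  qed simp
  have "phi powr (1 / 4) \<le> 12 / 10"
  proof (rule power_le_imp_le_base[of _ 3])
    show "(phi powr (1 / 4)) ^ Suc 3 \<le> (12 / 10) ^ Suc 3"
      using phi_le phi_gt_1 powr_power[of phi "1 / 4" 4] by (simp add: eval_nat_numeral)
  qed simp
  have "(\<Sum>n. real (fib (Suc n)) powr - (1 / 4)) \<le> (\<Sum>n. phi powr (1 / 4) * r ^ n)"
    unfolding r_def using phi_powr_less_1[of "1 / 4"]
    by (intro suminf_le fib_powr_le summable_fib_powr summable_mult summable_geometric) auto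
  also have "\<dots> = phi powr (1 / 4) * (1 / (1 - r))"
    using r by (simp add: suminf_mult suminf_geometric summable_geometric)
  also have "\<dots> \<le> 12 / 10 * 10"
    using r9 \<open>phi powr (1 / 4) \<le> 12 / 10\<close> r by (intro mult_mono) (auto simp: field_simps)
  finally show ?thesis
    by simp
qed

text \<open>One or two logarithms are paid for with y^(1/4), leaving y^(-1/4) out of y^(-1/2). The
  resulting majorants of the first and second derivatives do not depend on s.\<close>

lemma ln_powr_le:
  fixes y s :: real
  assumes "1 \<le> y" "1 / 2 \<le> s"
  shows "ln y * y powr - s \<le> 4 * y powr - (1 / 4)"
    and "(ln y)\<^sup>2 * y powr - s \<le> 64 * y powr - (1 / 4)"
proof -
  have s: "y powr - s \<le> y powr - (1 / 2)"
    using assms by (intro powr_mono) auto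
  have "ln y \<le> y powr (1 / 4) / (1 / 4)" "ln y \<le> y powr (1 / 8) / (1 / 8)"
    using assms by (intro ln_powr_bound; simp)+
  then have l: "ln y \<le> 4 * y powr (1 / 4)" "ln y \<le> 8 * y powr (1 / 8)"
    by simp_all
  have "ln y * y powr - s \<le> 4 * y powr (1 / 4) * y powr - (1 / 2)"
    using l s assms by (intro mult_mono) auto
  then show "ln y * y powr - s \<le> 4 * y powr - (1 / 4)"
    by (simp add: mult.assoc flip: powr_add)
  have "(ln y)\<^sup>2 * y powr - s \<le> (8 * y powr (1 / 8))\<^sup>2 * y powr - (1 / 2)"
    using l s assms by (intro mult_mono power_mono) auto
  also have "\<dots> = 64 * y powr - (1 / 4)"
    by (simp add: power2_eq_square flip: powr_add)
  finally show "(ln y)\<^sup>2 * y powr - s \<le> 64 * y powr - (1 / 4)" .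
qed

lemma summable_ln_fib_powr:
  assumes "1 / 2 \<le> s"
  shows "summable (\<lambda>n. ln (fib (Suc n)) * real (fib (Suc n)) powr - s)"
proof (rule summable_comparison_test)
  show "summable (\<lambda>n. 4 * real (fib (Suc n)) powr - (1 / 4))"
    by (intro summable_mult summable_fib_powr) simp
  show "\<exists>N. \<forall>n\<ge>N. norm (ln (fib (Suc n)) * real (fib (Suc n)) powr - s)
      \<le> 4 * real (fib (Suc n)) powr - (1 / 4)"
    using ln_powr_le(1)[OF fib_ge_1 assms] fib_ge_1 by (auto simp: abs_mult simp del: fib.simps)
qed

text \<open>This is -H', differentiated term by term (\<open>H_deriv\<close>); the sign makes it
  positive where it is needed.\<close>

definition H_slope :: "real \<Rightarrow> real" where
  "H_slope s = (\<Sum>n. ln (fib (Suc n)) * real (fib (Suc n)) powr - s) - 2 * ln 144 * 144 powr - s"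

definition H_part :: "nat \<Rightarrow> real \<Rightarrow> real" where
  "H_part N s = (\<Sum>n=1..N. real (fib n) powr - s) - 4 - 2 * 144 powr - s"

definition H_part_slope :: "nat \<Rightarrow> real \<Rightarrow> real" where
  "H_part_slope N s = (\<Sum>n=1..N. ln (fib n) * real (fib n) powr - s) - 2 * ln 144 * 144 powr - s"

section \<open>Derivatives of \<open>H\<close> and its truncations, with bounds\<close>

lemma DERIV_powr_minus:
  fixes c x :: real
  assumes "0 < c"
  shows "((\<lambda>x. c powr - x) has_real_derivative - (ln c * c powr - x)) (at x within X)"
proof (rule has_field_derivative_at_within)
  show "((\<lambda>x. c powr - x) has_real_derivative - (ln c * c powr - x)) (at x)"
    using assms by (auto intro!: derivative_eq_intros)
qed

lemma H_part_deriv: "(H_part N has_real_derivative - H_part_slope N s) (at s)"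
proof -
  have "((\<lambda>s. (\<Sum>n=1..N. real (fib n) powr - s) - 4 - 2 * 144 powr - s) has_real_derivative
      (\<Sum>n=1..N. - (ln (fib n) * real (fib n) powr - s)) - 0 - 2 * (- (ln 144 * 144 powr - s))) (at s)"
    by (intro DERIV_diff DERIV_cmult DERIV_const DERIV_sum DERIV_powr_minus) (auto simp: fib_neq_0_nat)
  then show ?thesis
    by (simp add: H_part_def[abs_def] H_part_slope_def sum_negf algebra_simps)
qed

lemma H_deriv:
  assumes "1 / 2 < s"
  shows "(H has_real_derivative - H_slope s) (at s)"
proof -
  have "((\<lambda>s. \<Sum>n. real (fib (Suc n)) powr - s) has_real_derivative
      (\<Sum>n. - (ln (fib (Suc n)) * real (fib (Suc n)) powr - s))) (at s)"
  proof (rule has_field_derivative_series'(2))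
    show "uniformly_convergent_on {1 / 2..}
        (\<lambda>n x. \<Sum>i<n. - (ln (fib (Suc i)) * real (fib (Suc i)) powr - x))"
    proof (rule Weierstrass_m_test'_ev)
      show "summable (\<lambda>n. 4 * real (fib (Suc n)) powr - (1 / 4))"
        by (intro summable_mult summable_fib_powr) simp
      show "\<forall>\<^sub>F n in sequentially. \<forall>x\<in>{1 / 2..}. norm (- (ln (fib (Suc n)) * real (fib (Suc n)) powr - x))
          \<le> 4 * real (fib (Suc n)) powr - (1 / 4)"
        using ln_powr_le(1)[OF fib_ge_1] fib_ge_1
        by (intro always_eventually) (auto simp: abs_mult simp del: fib.simps)
    qed
    \<comment> \<open>Convergence at the single point 1 suffices next to the uniform convergence of
      the derivatives.\<close>
    show "summable (\<lambda>n. real (fib (Suc n)) powr - 1)"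
      by (rule summable_fib_powr) simp
    show "((\<lambda>x. real (fib (Suc n)) powr - x) has_real_derivative
        - (ln (fib (Suc n)) * real (fib (Suc n)) powr - x)) (at x within {1 / 2..})" for n x
      by (rule DERIV_powr_minus) (simp add: fib_neq_0_nat del: fib.simps)
  qed (use assms in auto)
  then have "((\<lambda>s. (\<Sum>n. real (fib (Suc n)) powr - s) - 4 - 2 * 144 powr - s) has_real_derivative
      (\<Sum>n. - (ln (fib (Suc n)) * real (fib (Suc n)) powr - s)) - 0 - 2 * (- (ln 144 * 144 powr - s))) (at s)"
    by (intro DERIV_diff DERIV_cmult DERIV_const DERIV_powr_minus) auto
  then show ?thesis
    using summable_ln_fib_powr[of s] assms
    by (simp add: H_def[abs_def] Z_F_def[abs_def] H_slope_def suminf_minus algebra_simps del: fib.simps)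
qed

text \<open>Each term is Lipschitz by the bound on (ln y)^2 * y^(-s). The series contributes 64 * 12
  = 768 and the two copies of the 144 term 2 * 64 = 128, together below 900.\<close>

lemma H_slope_lipschitz:
  assumes "1 / 2 \<le> s" "1 / 2 \<le> t"
  shows "\<bar>H_slope s - H_slope t\<bar> \<le> 900 * \<bar>s - t\<bar>"
proof -
  have pt: "\<bar>ln y * y powr - s - ln y * y powr - t\<bar> \<le> 64 * y powr - (1 / 4) * \<bar>s - t\<bar>"
    if "1 \<le> y" for y :: real
  proof -
    have "norm (ln y * y powr - s - ln y * y powr - t) \<le> 64 * y powr - (1 / 4) * norm (s - t)"
    proof (rule field_differentiable_bound)
      show "convex {1 / 2 :: real..}"
        by (rule convex_real_interval)
      show "((\<lambda>s. ln y * y powr - s) has_field_derivative ln y * - (ln y * y powr - x))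
          (at x within {1 / 2..})" for x
        using that by (intro DERIV_cmult DERIV_powr_minus) simp
      show "norm (ln y * - (ln y * y powr - x)) \<le> 64 * y powr - (1 / 4)" if "x \<in> {1 / 2..}" for x
        using ln_powr_le(2)[OF \<open>1 \<le> y\<close>, of x] that
        by (simp add: abs_mult power2_eq_square mult.assoc)
    qed (use assms in auto)
    then show ?thesis
      by simp
  qed
  let ?f = "\<lambda>s n. ln (fib (Suc n)) * real (fib (Suc n)) powr - s"
  have M: "summable (\<lambda>n. real (fib (Suc n)) powr - (1 / 4))"
    by (rule summable_fib_powr) simp
  have "norm (\<Sum>n. ?f s n - ?f t n) \<le> (\<Sum>n. 64 * real (fib (Suc n)) powr - (1 / 4) * \<bar>s - t\<bar>)"
    using pt[OF fib_ge_1] by (intro norm_suminf_le summable_mult2 summable_mult M) simp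
  also have "\<dots> = 64 * (\<Sum>n. real (fib (Suc n)) powr - (1 / 4)) * \<bar>s - t\<bar>"
    using M by (simp only: suminf_mult2[symmetric] suminf_mult[symmetric] summable_mult)
  also have "\<dots> \<le> 64 * 12 * \<bar>s - t\<bar>"
    using suminf_fib_powr_quarter_le by (intro mult_right_mono mult_left_mono) auto
  finally have sum: "\<bar>(\<Sum>n. ?f s n) - (\<Sum>n. ?f t n)\<bar> \<le> 768 * \<bar>s - t\<bar>"
    using suminf_diff[OF summable_ln_fib_powr summable_ln_fib_powr, OF assms] by simp
  have "\<bar>ln 144 * 144 powr - s - ln 144 * 144 powr - t\<bar> \<le> 64 * 144 powr - (1 / 4) * \<bar>s - t\<bar>"
    by (rule pt) simp
  also have "\<dots> \<le> 64 * 1 * \<bar>s - t\<bar>"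
    using powr_mono[of "- (1 / 4)" 0 "144 :: real"] by (intro mult_right_mono mult_left_mono) auto
  finally show ?thesis
    using sum by (simp add: H_slope_def)
qed

lemma H_part_slope_mono: "M \<le> N \<Longrightarrow> H_part_slope M s \<le> H_part_slope N s"
  unfolding H_part_slope_def by (intro diff_right_mono sum_mono2) (auto simp: ln_fib_nonneg)

text \<open>Since F_12 = 144, the term n = 12 cancels one of the two negative copies; this is where
  N >= 12 enters. The terms for F_3 = 2 and F_4 = 3 outweigh the other copy.\<close>

lemma H_part_slope_ge:
  assumes N: "12 \<le> N" and s: "1 / 2 \<le> s" "s \<le> 3 / 4"
  shows "1 / 4 \<le> H_part_slope N s"
proof -
  have fibs: "fib 3 = 2" "fib 4 = 3" "fib 12 = 144"
    by (simp_all add: eval_nat_numeral)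
  have "(\<Sum>n\<in>{3, 4, 12}. ln (fib n) * real (fib n) powr - s)
      \<le> (\<Sum>n=1..12. ln (fib n) * real (fib n) powr - s)"
    by (intro sum_mono2) (auto simp: ln_fib_nonneg)
  then have *: "ln 2 * 2 powr - s + ln 3 * 3 powr - s - ln 144 * 144 powr - s \<le> H_part_slope 12 s"
    by (simp add: H_part_slope_def fibs)
  \<comment> \<open>Raising to the fourth power turns 2^(-3/4) into 1/8; likewise 3^(-3/4) becomes
    1/27 below.\<close>
  have "(59 / 100) ^ Suc 3 \<le> (2 powr - (3 / 4) :: real) ^ Suc 3"
    using powr_power[of "2 :: real" "- (3 / 4)" 4] powr_realpow[of "2 :: real" 3]
    by (simp add: eval_nat_numeral powr_minus_divide)
  then have "59 / 100 \<le> (2 powr - (3 / 4) :: real)"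
    by (rule power_le_imp_le_base) simp
  also have "\<dots> \<le> 2 powr - s"
    using s by simp
  finally have ln2: "2 / 3 * (59 / 100) \<le> ln 2 * 2 powr - s"
    using ln2_ge_two_thirds by (intro mult_mono) auto
  have "(43 / 100) ^ Suc 3 \<le> (3 powr - (3 / 4) :: real) ^ Suc 3"
    using powr_power[of "3 :: real" "- (3 / 4)" 4] powr_realpow[of "3 :: real" 3]
    by (simp add: eval_nat_numeral powr_minus_divide)
  then have "43 / 100 \<le> (3 powr - (3 / 4) :: real)"
    by (rule power_le_imp_le_base) simp
  also have "\<dots> \<le> 3 powr - s"
    using s by simp
  finally have ln3: "1 * (43 / 100) \<le> ln 3 * 3 powr - s"
    using exp_le by (intro mult_mono) (auto simp: ln_ge_iff)
  have "ln (144 :: real) \<le> ln (2 ^ 8)"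
    by simp
  also have "\<dots> = 8 * ln 2"
    by (subst ln_realpow) auto
  finally have ln144: "ln (144 :: real) \<le> 50 / 9"
    using ln2_le_25_over_36 by simp
  have "144 powr - s \<le> (144 powr - (1 / 2) :: real)"
    using s by simp
  then have "144 powr - s \<le> (1 / 12 :: real)"
    by (simp add: powr_minus_divide powr_half_sqrt)
  with ln144 have "ln 144 * 144 powr - s \<le> 50 / 9 * (1 / 12 :: real)"
    by (intro mult_mono) auto
  then have "1 / 4 \<le> H_part_slope 12 s"
    using * ln2 ln3 by simp
  then show ?thesis
    using H_part_slope_mono[OF N, of s] by simp
qed

definition Z_tail :: "nat \<Rightarrow> real \<Rightarrow> real" where
  "Z_tail N s = (\<Sum>n. real (fib (Suc N + n)) powr - s)"

lemma sum_fib_shift: "(\<Sum>n<N. f (fib (Suc n))) = (\<Sum>n=1..N. f (fib n))"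
  by (simp add: sum.atLeast1_atMost_eq)

lemma H_split: "0 < s \<Longrightarrow> H s = H_part N s + Z_tail N s"
  using suminf_split_initial_segment[OF summable_fib_powr, of s N]
    sum_fib_shift[of "\<lambda>k. real k powr - s" N]
  by (simp add: H_def Z_F_def H_part_def Z_tail_def add.commute sum_fib_shift del: fib.simps)

lemma H_slope_split:
  assumes "1 / 2 \<le> s"
  shows "H_slope s = H_part_slope N s + (\<Sum>n. ln (fib (Suc N + n)) * real (fib (Suc N + n)) powr - s)"
  using suminf_split_initial_segment[OF summable_ln_fib_powr, OF assms, of N]
    sum_fib_shift[of "\<lambda>k. ln k * real k powr - s" N]
  by (simp add: H_slope_def H_part_slope_def add.commute del: fib.simps)

text \<open>The upper bound is free of s, which makes the convergence of the truncated slopes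
  uniform.\<close>

lemma H_slope_minus_H_part_slope:
  assumes "1 / 2 \<le> s"
  shows "0 \<le> H_slope s - H_part_slope N s"
    and "H_slope s - H_part_slope N s \<le> 4 * (\<Sum>n. real (fib (Suc N + n)) powr - (1 / 4))"
proof -
  have sm: "summable (\<lambda>n. ln (fib (Suc N + n)) * real (fib (Suc N + n)) powr - s)"
    "summable (\<lambda>n. real (fib (Suc N + n)) powr - (1 / 4))"
    using summable_ignore_initial_segment[OF summable_ln_fib_powr, OF assms, of N]
      summable_ignore_initial_segment[OF summable_fib_powr, of "1 / 4" N]
    by (simp_all add: add.commute del: fib.simps)
  have eq: "H_slope s - H_part_slope N s = (\<Sum>n. ln (fib (Suc N + n)) * real (fib (Suc N + n)) powr - s)"
    using H_slope_split[OF assms, of N] by simp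
  show "0 \<le> H_slope s - H_part_slope N s"
    unfolding eq by (intro suminf_nonneg sm mult_nonneg_nonneg ln_fib_nonneg) simp
  have "(\<Sum>n. ln (fib (Suc N + n)) * real (fib (Suc N + n)) powr - s)
      \<le> (\<Sum>n. 4 * real (fib (Suc N + n)) powr - (1 / 4))"
    using ln_powr_le(1)[OF fib_ge_1 assms] by (intro suminf_le sm summable_mult) auto
  then show "H_slope s - H_part_slope N s \<le> 4 * (\<Sum>n. real (fib (Suc N + n)) powr - (1 / 4))"
    unfolding eq using sm(2) by (simp only: suminf_mult)
qed

lemma H_slope_ge: "1 / 2 \<le> s \<Longrightarrow> s \<le> 3 / 4 \<Longrightarrow> 1 / 4 \<le> H_slope s"
  using H_slope_minus_H_part_slope(1)[of s 12] H_part_slope_ge[of 12 s] by simp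

lemma H_strict_decreasing:
  assumes "1 / 2 < s" "s < t" "t \<le> 3 / 4"
  shows "H t < H s"
proof (rule DERIV_neg_imp_decreasing[OF \<open>s < t\<close>])
  show "\<exists>y. (H has_real_derivative y) (at x) \<and> y < 0" if "s \<le> x" "x \<le> t" for x
    using that assms H_slope_ge[of x] H_deriv[of x] by (intro exI[of _ "- H_slope x"]) auto
qed

lemma H_part_strict_decreasing:
  assumes "12 \<le> N" "1 / 2 \<le> s" "s < t" "t \<le> 3 / 4"
  shows "H_part N t < H_part N s"
proof (rule DERIV_neg_imp_decreasing[OF \<open>s < t\<close>])
  show "\<exists>y. (H_part N has_real_derivative y) (at x) \<and> y < 0" if "s \<le> x" "x \<le> t" for x
    using that assms H_part_slope_ge[of N x] H_part_deriv[of N x] by (intro exI[of _ "- H_part_slope N x"]) auto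
qed

section \<open>Tails as almost geometric series\<close>

lemma powr_near_1:
  fixes y s \<epsilon> :: real
  assumes y: "\<bar>y - 1\<bar> \<le> \<epsilon>" and \<epsilon>: "\<epsilon> \<le> 1 / 2" and s: "0 \<le> s" "s \<le> 1"
  shows "1 - \<epsilon> \<le> y powr - s" "y powr - s \<le> 1 + 2 * \<epsilon>" "\<bar>ln y\<bar> \<le> 2 * \<epsilon>"
    "1 - \<epsilon> \<le> y powr s" "y powr s \<le> 1 + \<epsilon>"
proof -
  have \<epsilon>0: "0 \<le> \<epsilon>" and y0: "0 < y" and yb: "1 - \<epsilon> \<le> y" "y \<le> 1 + \<epsilon>"
    using y \<epsilon> by auto
  have up: "u powr s \<le> max 1 u" "min 1 u \<le> u powr s" if "0 < u" for u :: real
    using that s powr_mono[of s 1 u] powr_mono'[of s 1 u] powr_mono[of 0 s u] powr_mono'[of 0 s u]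
    by (cases "1 \<le> u"; simp)+
  show p: "1 - \<epsilon> \<le> y powr s" "y powr s \<le> 1 + \<epsilon>"
    using up[OF y0] yb \<epsilon>0 by auto
  have ps: "0 < y powr s" and inv: "y powr - s = 1 / y powr s"
    using y0 by (simp_all add: powr_minus_divide)
  have "1 - \<epsilon> \<le> 1 / (1 + \<epsilon>)"
    using \<epsilon>0 by (simp add: field_simps)
  also have "\<dots> \<le> 1 / y powr s"
    using p ps \<epsilon>0 by (intro divide_left_mono) auto
  finally show "1 - \<epsilon> \<le> y powr - s"
    by (simp add: inv)
  \<comment> \<open>Multiplied out, this says 2 * \<epsilon>^2 <= \<epsilon>, which is where
    \<epsilon> <= 1/2 enters.\<close>
  have q: "1 / (1 - \<epsilon>) \<le> 1 + 2 * \<epsilon>"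
    using \<epsilon> \<epsilon>0 mult_left_mono[OF \<epsilon> \<epsilon>0] by (simp add: field_simps)
  have "1 / y powr s \<le> 1 / (1 - \<epsilon>)"
    using p ps \<epsilon> by (intro divide_left_mono) auto
  then show "y powr - s \<le> 1 + 2 * \<epsilon>"
    using q by (simp add: inv)
  have "ln y \<le> y - 1"
    using y0 by (rule ln_le_minus_one)
  moreover have "1 / y \<le> 1 / (1 - \<epsilon>)"
    using yb y0 \<epsilon> by (intro divide_left_mono) auto
  moreover have "- ln y \<le> 1 / y - 1"
    using y0 ln_le_minus_one[of "1 / y"] by (simp add: ln_div)
  ultimately show "\<bar>ln y\<bar> \<le> 2 * \<epsilon>"
    using q yb \<epsilon>0 by linarith
qed

text \<open>Write F_(m+n) = y * F_m * phi^n, where |y - 1| <= \<epsilon> by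
  \<open>fib_ratio_bound\<close>, and apply \<open>powr_near_1\<close> to y. From m >= 3 follows F_m
  >= 2, hence \<epsilon> <= 1/4.\<close>

lemma fib_add_powr_bounds:
  fixes \<epsilon> s :: real and m n :: nat
  assumes m: "3 \<le> m" and s: "0 < s" "s \<le> 1"
  defines "\<epsilon> \<equiv> 1 / real (fib m) ^ 2" and "p \<equiv> real (fib m) powr - s * (phi powr - s) ^ n"
  shows "p * (1 - \<epsilon>) \<le> real (fib (m + n)) powr - s"
    and "real (fib (m + n)) powr - s \<le> p * (1 + 2 * \<epsilon>)"
    and "\<bar>ln (fib (m + n)) - (ln (fib m) + n * ln phi)\<bar> \<le> 2 * \<epsilon>"
    and "\<epsilon> \<le> 1 / 2"
proof -
  define y where "y = fib (m + n) / (fib m * phi ^ n)"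
  have "2 \<le> real (fib m)"
    using fib_mono[OF m] by (simp add: eval_nat_numeral)
  then have "2\<^sup>2 \<le> real (fib m) ^ 2"
    by (intro power_mono) auto
  then have "\<epsilon> \<le> 1 / 2\<^sup>2"
    unfolding \<epsilon>_def using \<open>2 \<le> real (fib m)\<close> by (intro divide_left_mono) auto
  then show \<epsilon>: "\<epsilon> \<le> 1 / 2"
    by simp
  have F: "0 < real (fib m)" "0 < phi ^ n"
    using \<open>2 \<le> real (fib m)\<close> phi_gt_1 by auto
  have y1: "\<bar>y - 1\<bar> \<le> \<epsilon>"
    unfolding y_def \<epsilon>_def using m by (intro fib_ratio_bound) simp
  then have "0 < y"
    using \<epsilon> by linarith
  have eq: "real (fib (m + n)) = y * (fib m * phi ^ n)"
    unfolding y_def using F(1) phi_gt_1 by simp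
  have "(phi ^ n) powr - s = (phi powr - s) ^ n"
    using phi_gt_1 by (simp add: powr_powr powr_power mult.commute flip: powr_realpow)
  then have powr: "real (fib (m + n)) powr - s = p * y powr - s"
    using F \<open>0 < y\<close> by (simp add: eq p_def powr_mult)
  have "0 \<le> p"
    by (simp add: p_def)
  then show "p * (1 - \<epsilon>) \<le> real (fib (m + n)) powr - s"
    "real (fib (m + n)) powr - s \<le> p * (1 + 2 * \<epsilon>)"
    unfolding powr using s powr_near_1(1,2)[OF y1 \<epsilon>, of s] by (auto intro!: mult_left_mono)
  have "ln (fib (m + n)) = ln y + (ln (fib m) + n * ln phi)"
    using F \<open>0 < y\<close> phi_gt_1 by (simp add: eq ln_mult ln_realpow)
  then show "\<bar>ln (fib (m + n)) - (ln (fib m) + n * ln phi)\<bar> \<le> 2 * \<epsilon>"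
    using powr_near_1(3)[OF y1 \<epsilon>, of s] s by simp
qed

text \<open>Needed because the logarithms of F_(m+n) grow linearly in n.\<close>

lemma geometric_moment_sums:
  fixes x :: real
  assumes "0 \<le> x" "x < 1"
  shows "(\<lambda>n. real n * x ^ n) sums (x / (1 - x)\<^sup>2)"
proof -
  have "(\<lambda>n. x * (of_nat (Suc n) * x ^ n)) sums (x * (1 / (1 - x)\<^sup>2))"
    using assms by (intro sums_mult geometric_deriv_sums) auto
  then have "(\<lambda>n. real (Suc n) * x ^ Suc n) sums (x / (1 - x)\<^sup>2)"
    by (simp add: mult_ac)
  from sums_Suc_imp[OF _ this] show ?thesis
    by simp
qed

context
  fixes N :: nat and s \<epsilon> x P L :: real
  assumes N: "3 \<le> N" and s: "1 / 2 \<le> s" "s \<le> 1"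
  defines "\<epsilon> \<equiv> 1 / real (fib (Suc N)) ^ 2" and "x \<equiv> phi powr - s"
    and "P \<equiv> real (fib (Suc N)) powr - s" and "L \<equiv> ln (fib (Suc N))"
begin

lemma phi_powr_unit_interval: "0 < x" "x < 1"
  using phi_powr_less_1[of s] s phi_gt_1 by (auto simp: x_def)

lemma Z_tail_bounds:
  "P / (1 - x) * (1 - \<epsilon>) \<le> Z_tail N s" "Z_tail N s \<le> P / (1 - x) * (1 + 2 * \<epsilon>)"
proof -
  have g: "(\<lambda>n. P * x ^ n * c) sums (P / (1 - x) * c)" for c
    using sums_mult2[OF sums_mult[OF geometric_sums[of x], of P], of c] phi_powr_unit_interval by simp
  have r: "(\<lambda>n. real (fib (Suc N + n)) powr - s) sums Z_tail N s"
    using summable_ignore_initial_segment[OF summable_fib_powr, of s N] s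
    unfolding Z_tail_def by (intro summable_sums) (simp add: add.commute del: fib.simps)
  have b: "P * x ^ n * (1 - \<epsilon>) \<le> real (fib (Suc N + n)) powr - s"
    "real (fib (Suc N + n)) powr - s \<le> P * x ^ n * (1 + 2 * \<epsilon>)" for n
    using fib_add_powr_bounds(1,2)[of "Suc N" s n] N s unfolding P_def x_def \<epsilon>_def by simp_all
  show "P / (1 - x) * (1 - \<epsilon>) \<le> Z_tail N s" "Z_tail N s \<le> P / (1 - x) * (1 + 2 * \<epsilon>)"
    using sums_le[OF b(1) g r] sums_le[OF b(2) r g] .
qed

text \<open>\<open>E\<close> is the tail that an exactly geometric F_(m+n) would give. The logarithm
  and the power each carry a relative error, and \<epsilon> <= 1/2 lets the products (1 -
  2\<epsilon>)(1 - \<epsilon>) and (1 + 2\<epsilon>)^2 be replaced by linear factors.\<close>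

lemma H_slope_tail_bounds:
  defines "E \<equiv> P * (L / (1 - x) + ln phi * x / (1 - x)\<^sup>2)"
  shows "E * (1 - 3 * \<epsilon>) \<le> H_slope s - H_part_slope N s" "H_slope s - H_part_slope N s \<le> E * (1 + 6 * \<epsilon>)"
proof -
  have g: "(\<lambda>n. (L + n * ln phi) * (P * x ^ n) * c) sums (E * c)" for c
  proof -
    have "(\<lambda>n. (P * L * x ^ n + P * ln phi * (n * x ^ n)) * c)
        sums ((P * L * (1 / (1 - x)) + P * ln phi * (x / (1 - x)\<^sup>2)) * c)"
      using phi_powr_unit_interval by (intro sums_mult2 sums_add sums_mult geometric_sums geometric_moment_sums) auto
    then show ?thesis
      by (simp add: E_def algebra_simps)
  qed
  have r: "(\<lambda>n. ln (fib (Suc N + n)) * real (fib (Suc N + n)) powr - s) sums (H_slope s - H_part_slope N s)"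
    using summable_ignore_initial_segment[OF summable_ln_fib_powr, of s N] s H_slope_split[of s N]
    by (simp add: sums_iff add.commute del: fib.simps)
  have "3 \<le> real (fib (Suc N))"
    using fib_mono[of 4 "Suc N"] N by (simp add: eval_nat_numeral)
  then have L: "1 \<le> L"
    using exp_le by (auto simp: L_def ln_ge_iff)
  have bnd: "(L + n * ln phi) * (P * x ^ n) * (1 - 3 * \<epsilon>) \<le> ln (fib (Suc N + n)) * real (fib (Suc N + n)) powr - s"
    "ln (fib (Suc N + n)) * real (fib (Suc N + n)) powr - s \<le> (L + n * ln phi) * (P * x ^ n) * (1 + 6 * \<epsilon>)" for n
  proof -
    define l p where "l = L + n * ln phi" and "p = P * x ^ n"
    have l: "1 \<le> l"
      using L phi_gt_1 by (simp add: l_def add_increasing2)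
    have p: "0 \<le> p"
      using phi_powr_unit_interval by (simp add: p_def P_def)
    have \<epsilon>: "\<epsilon> \<le> 1 / 2" "0 \<le> \<epsilon>"
      using fib_add_powr_bounds(4)[of "Suc N" s] N s by (simp_all add: \<epsilon>_def)
    have b: "p * (1 - \<epsilon>) \<le> real (fib (Suc N + n)) powr - s"
      "real (fib (Suc N + n)) powr - s \<le> p * (1 + 2 * \<epsilon>)"
      "\<bar>ln (fib (Suc N + n)) - l\<bar> \<le> 2 * \<epsilon>"
      using fib_add_powr_bounds(1,2,3)[of "Suc N" s n] N s
      unfolding P_def x_def \<epsilon>_def p_def l_def L_def by simp_all
    \<comment> \<open>As l >= 1, the absolute error of the logarithm becomes a relative one.\<close>
    have le: "2 * \<epsilon> \<le> 2 * \<epsilon> * l"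
      using l \<epsilon> by (simp add: mult_le_cancel_left1)
    have "l * (1 - 2 * \<epsilon>) \<le> ln (fib (Suc N + n))" "ln (fib (Suc N + n)) \<le> l * (1 + 2 * \<epsilon>)"
      using b(3) le by (simp_all add: algebra_simps)
    then have "l * (1 - 2 * \<epsilon>) * (p * (1 - \<epsilon>)) \<le> ln (fib (Suc N + n)) * real (fib (Suc N + n)) powr - s"
      "ln (fib (Suc N + n)) * real (fib (Suc N + n)) powr - s \<le> l * (1 + 2 * \<epsilon>) * (p * (1 + 2 * \<epsilon>))"
      using b l p \<epsilon> by (auto intro!: mult_mono simp: ln_fib_nonneg simp del: fib.simps)
    moreover have "l * p * (1 - 3 * \<epsilon>) \<le> l * p * ((1 - 2 * \<epsilon>) * (1 - \<epsilon>))"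
      using l p \<epsilon> by (intro mult_left_mono) (auto simp: algebra_simps)
    moreover have "l * p * ((1 + 2 * \<epsilon>) * (1 + 2 * \<epsilon>)) \<le> l * p * (1 + 6 * \<epsilon>)"
      using l p \<epsilon> mult_left_mono[OF \<epsilon>] by (intro mult_left_mono) (auto simp: algebra_simps)
    ultimately show "l * p * (1 - 3 * \<epsilon>) \<le> ln (fib (Suc N + n)) * real (fib (Suc N + n)) powr - s"
      "ln (fib (Suc N + n)) * real (fib (Suc N + n)) powr - s \<le> l * p * (1 + 6 * \<epsilon>)"
      by (simp_all add: mult_ac del: fib.simps)
  qed
  show "E * (1 - 3 * \<epsilon>) \<le> H_slope s - H_part_slope N s" "H_slope s - H_part_slope N s \<le> E * (1 + 6 * \<epsilon>)"
    using sums_le[OF bnd(1) g r] sums_le[OF bnd(2) r g] .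
qed

end

lemma fib_div_phi_power_tendsto: "(\<lambda>n. real (fib n) / phi ^ n) \<longlonglongrightarrow> 1 / sqrt 5"
proof -
  have "\<bar>(1 - phi) / phi\<bar> < 1"
    using phi_gt_1 phi_le by (simp add: abs_if divide_simps)
  then have "(\<lambda>n. ((1 - phi) / phi) ^ n) \<longlonglongrightarrow> 0"
    by (intro LIMSEQ_power_zero) (simp only: real_norm_def)
  then have "(\<lambda>n. (1 - ((1 - phi) / phi) ^ n) / sqrt 5) \<longlonglongrightarrow> (1 - 0) / sqrt 5"
    by (intro tendsto_divide tendsto_diff tendsto_const) auto
  moreover have "(1 - ((1 - phi) / phi) ^ n) / sqrt 5 = real (fib n) / phi ^ n" for n
  proof -
    have psi: "1 - phi = (1 - sqrt 5) / 2"
      by (simp add: phi_def field_simps)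
    have "real (fib n) = (phi ^ n - (1 - phi) ^ n) / sqrt 5"
      unfolding psi using fib_closed_form[of n] by (simp add: phi_def)
    then have "real (fib n) / phi ^ n = (phi ^ n - (1 - phi) ^ n) / phi ^ n / sqrt 5"
      by (simp add: mult.commute)
    also have "(phi ^ n - (1 - phi) ^ n) / phi ^ n = 1 - ((1 - phi) / phi) ^ n"
      unfolding power_divide using phi_gt_1 by (simp add: diff_divide_distrib)
    finally show ?thesis
      by simp
  qed
  ultimately show ?thesis
    by simp
qed

text \<open>Squeeze with \<open>Z_tail_bounds\<close>: after normalisation the main term is
  (F_(N+1)/phi^(N+1))^(-s) / (1 - phi^(-s)). Binet's formula sends the base to 1/sqrt 5, whence the
  factor 5^(s/2).\<close>

lemma Z_tail_asymptotics:
  assumes s: "1 / 2 \<le> s" "s \<le> 1"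
  shows "(\<lambda>N. Z_tail N s * phi powr ((real N + 1) * s)) \<longlonglongrightarrow> 5 powr (s / 2) / (1 - phi powr - s)"
proof -
  define g where "g N = real (fib (Suc N)) powr - s / (1 - phi powr - s) * phi powr ((real N + 1) * s)" for N
  define \<epsilon> where "\<epsilon> N = 1 / real (fib (Suc N)) ^ 2" for N
  have "g = (\<lambda>N. (real (fib (Suc N)) / phi ^ Suc N) powr - s / (1 - phi powr - s))"
    using phi_gt_1 by (intro ext) (simp add: g_def powr_divide powr_minus_divide powr_powr add.commute
      flip: powr_realpow del: fib.simps power_Suc)
  moreover have "(\<lambda>N. (real (fib (Suc N)) / phi ^ Suc N) powr - s / (1 - phi powr - s))
      \<longlonglongrightarrow> (1 / sqrt 5) powr - s / (1 - phi powr - s)"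
    using phi_powr_less_1[of s] s
    by (intro tendsto_intros LIMSEQ_Suc fib_div_phi_power_tendsto) auto
  moreover have "(1 / sqrt 5) powr - s = 5 powr (s / 2)"
    by (simp add: powr_divide powr_minus_divide powr_powr flip: powr_half_sqrt)
  ultimately have g: "g \<longlonglongrightarrow> 5 powr (s / 2) / (1 - phi powr - s)"
    by (simp only:)
  have "\<epsilon> = (\<lambda>N. (real (fib (Suc N)) powr - 1)\<^sup>2)"
    by (auto simp: \<epsilon>_def powr_minus_divide power_divide del: fib.simps)
  moreover have "(\<lambda>N. (real (fib (Suc N)) powr - 1)\<^sup>2) \<longlonglongrightarrow> 0\<^sup>2"
    by (intro tendsto_power summable_LIMSEQ_zero summable_fib_powr) simp
  ultimately have \<epsilon>: "\<epsilon> \<longlonglongrightarrow> 0"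
    by simp
  have lim: "(\<lambda>N. g N * (1 + c * \<epsilon> N)) \<longlonglongrightarrow> 5 powr (s / 2) / (1 - phi powr - s)" for c
    using tendsto_mult[OF g tendsto_add[OF tendsto_const[of 1] tendsto_mult_left[OF \<epsilon>, of c]]] by simp
  show ?thesis
  proof (rule tendsto_sandwich[OF _ _ lim[of "- 1"] lim[of 2]])
    show "\<forall>\<^sub>F N in sequentially. g N * (1 + - 1 * \<epsilon> N) \<le> Z_tail N s * phi powr ((real N + 1) * s)"
      using eventually_ge_at_top[of 3]
    proof eventually_elim
      case (elim N)
      then show ?case
        using mult_right_mono[OF Z_tail_bounds(1)[OF elim s], of "phi powr ((real N + 1) * s)"]
        by (simp add: g_def \<epsilon>_def mult_ac del: fib.simps)
    qed
    show "\<forall>\<^sub>F N in sequentially. Z_tail N s * phi powr ((real N + 1) * s) \<le> g N * (1 + 2 * \<epsilon> N)"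
      using eventually_ge_at_top[of 3]
    proof eventually_elim
      case (elim N)
      then show ?case
        using mult_right_mono[OF Z_tail_bounds(2)[OF elim s], of "phi powr ((real N + 1) * s)"]
        by (simp add: g_def \<epsilon>_def mult_ac del: fib.simps)
    qed
  qed
qed

lemma Z_tail_tendsto_0: "0 < s \<Longrightarrow> (\<lambda>N. Z_tail N s) \<longlonglongrightarrow> 0"
  unfolding Z_tail_def using suminf_exist_split2[OF summable_fib_powr, of s]
  by (simp add: add.commute del: fib.simps)

lemma Z_tail_pos:
  assumes "0 < s"
  shows "0 < Z_tail N s"
  unfolding Z_tail_def using summable_ignore_initial_segment[OF summable_fib_powr[OF assms], of N]
  by (intro suminf_pos) (auto simp: add.commute fib_neq_0_nat simp del: fib.simps)

section \<open>The zeros and the gap between them\<close>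

lemma sigma_F_eqI:
  assumes "0.7 < s" "s < 0.75" "H s = 0"
  shows "sigma_F = s"
  unfolding sigma_F_def
proof (rule the_equality)
  \<comment> \<open>Strict monotonicity gives the uniqueness that the definite description requires;
    existence is supplied later by \<open>root_bounds\<close>.\<close>
  show "t = s" if t: "0.7 < t \<and> t < 0.75 \<and> H t = 0" for t
    using assms t H_strict_decreasing[of s t] H_strict_decreasing[of t s]
    by (cases t s rule: linorder_cases) auto
qed (use assms in auto)

lemma sigma_N_eqI:
  assumes "12 \<le> N" "1 / 2 < s" "s < 3 / 4" "H_part N s = 0"
  shows "sigma_N N = s"
  unfolding sigma_N_def
proof (rule the_equality)
  show "t = s" if t: "1 / 2 < t \<and> t < 3 / 4 \<and> (\<Sum>n = 1..N. real (fib n) powr - t) = 4 + 2 * 144 powr - t" for t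
    using assms t H_part_strict_decreasing[of N s t] H_part_strict_decreasing[of N t s]
    by (cases t s rule: linorder_cases) (auto simp: H_part_def)
qed (use assms in \<open>auto simp: H_part_def\<close>)

text \<open>The truncation is positive at 0.7 and negative at s, so its zero lies between. The
  quotient is its slope at an intermediate point. Truncating the slope costs the first error term;
  the second comes from moving the point to s, with 3600 = 900 * 4 because the gap is at most 4 *
  \<open>Z_tail N s\<close>.\<close>

lemma sigma_N_gap:
  assumes N: "12 \<le> N" and s: "0.7 < s" "s < 0.75" "H s = 0" and pos: "Z_tail N 0.7 < H 0.7"
  shows "sigma_N N < s"
    and "\<bar>Z_tail N s / (s - sigma_N N) - H_slope s\<bar> \<le> 4 * Z_tail N (1 / 4) + 3600 * Z_tail N s"
proof -
  have "0 < H_part N 0.7"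
    using H_split[of "0.7" N] pos by simp
  have Hs: "H_part N s = - Z_tail N s"
    using H_split[of s N] s by simp
  then have "H_part N s < 0"
    using Z_tail_pos[of s N] s by simp
  have cont: "\<forall>x. 0.7 \<le> x \<and> x \<le> s \<longrightarrow> isCont (H_part N) x"
    using H_part_deriv DERIV_isCont by blast
  obtain t where t: "0.7 \<le> t" "t \<le> s" "H_part N t = 0"
    using IVT2[of "H_part N" s 0 "0.7"] \<open>0 < H_part N 0.7\<close> \<open>H_part N s < 0\<close> s cont by auto
  have "t \<noteq> s"
    using t(3) \<open>H_part N s < 0\<close> by auto
  then have "t < s"
    using t(2) by simp
  have sigma: "sigma_N N = t"
    using N t s \<open>t < s\<close> by (intro sigma_N_eqI) auto
  then show "sigma_N N < s"
    using \<open>t < s\<close> by simp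
  obtain \<xi> where \<xi>: "t < \<xi>" "\<xi> < s" "H_part N s - H_part N t = (s - t) * - H_part_slope N \<xi>"
    using MVT2[OF \<open>t < s\<close>, of "H_part N" "\<lambda>x. - H_part_slope N x"] H_part_deriv by blast
  have R_eq: "Z_tail N s = (s - t) * H_part_slope N \<xi>"
    using \<xi>(3) Hs t(3) by simp
  have "1 / 4 \<le> H_part_slope N \<xi>"
    using N \<xi> t s by (intro H_part_slope_ge) auto
  then have "(s - t) * (1 / 4) \<le> Z_tail N s"
    unfolding R_eq using \<open>t < s\<close> by (intro mult_left_mono) auto
  then have "\<bar>H_slope \<xi> - H_slope s\<bar> \<le> 3600 * Z_tail N s"
    using H_slope_lipschitz[of \<xi> s] \<xi> t s by simp
  moreover have "\<bar>H_slope \<xi> - H_part_slope N \<xi>\<bar> \<le> 4 * Z_tail N (1 / 4)"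
    using H_slope_minus_H_part_slope[of \<xi> N] \<xi> t unfolding Z_tail_def by simp
  ultimately have "\<bar>H_part_slope N \<xi> - H_slope s\<bar> \<le> 4 * Z_tail N (1 / 4) + 3600 * Z_tail N s"
    by linarith
  moreover have "Z_tail N s / (s - t) = H_part_slope N \<xi>"
    using \<open>t < s\<close> by (simp add: R_eq)
  ultimately show "\<bar>Z_tail N s / (s - sigma_N N) - H_slope s\<bar> \<le> 4 * Z_tail N (1 / 4) + 3600 * Z_tail N s"
    by (simp add: sigma)
qed

lemma C_F_eq:
  assumes "1 / 2 < sigma_F"
  shows "C_F = 5 powr (sigma_F / 2) / (H_slope sigma_F * (1 - phi powr - sigma_F))"
  using DERIV_imp_deriv[OF H_deriv[OF assms]] by (simp add: C_F_def)

lemma sigma_gap_asymptotics: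
  assumes s: "0.7 < s" "s < 0.75" "H s = 0"
  shows "(\<lambda>N. sigma_F - sigma_N N) \<sim>[sequentially] (\<lambda>N. C_F * phi powr (- (real N + 1) * sigma_F))"
proof -
  have sF: "sigma_F = s"
    using s by (rule sigma_F_eqI)
  define q where "q N = Z_tail N s / (s - sigma_N N)" for N
  define K where "K = 5 powr (s / 2) / (1 - phi powr - s)"
  have K: "0 < K"
    using phi_powr_less_1[of s] s by (simp add: K_def)
  have Dpos: "0 < H_slope s"
    using H_slope_ge[of s] s by simp
  have C: "C_F = K / H_slope s"
    using C_F_eq s by (simp add: K_def sF field_simps)
  have "0 < H 0.7"
    using H_strict_decreasing[of "0.7" s] s by simp
  then have ev: "\<forall>\<^sub>F N in sequentially. 12 \<le> N \<and> Z_tail N 0.7 < H 0.7"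
    using order_tendstoD(2)[OF Z_tail_tendsto_0[of "0.7"]] eventually_ge_at_top[of 12]
    by (auto intro: eventually_conj)
  have "(\<lambda>N. 4 * Z_tail N (1 / 4) + 3600 * Z_tail N s) \<longlonglongrightarrow> 4 * 0 + 3600 * 0"
    using s by (intro tendsto_intros Z_tail_tendsto_0) auto
  moreover have "\<forall>\<^sub>F N in sequentially. norm (q N - H_slope s) \<le> 4 * Z_tail N (1 / 4) + 3600 * Z_tail N s"
    using ev by eventually_elim (use sigma_N_gap(2)[OF _ s] in \<open>auto simp: q_def\<close>)
  ultimately have "(\<lambda>N. q N - H_slope s) \<longlonglongrightarrow> 0"
    by (intro Lim_null_comparison[of "\<lambda>N. q N - H_slope s"]) auto
  then have q: "q \<longlonglongrightarrow> H_slope s"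
    by (simp add: LIM_zero_iff)
  have "(\<lambda>N. Z_tail N s * phi powr ((real N + 1) * s)) \<longlonglongrightarrow> K"
    unfolding K_def using s by (intro Z_tail_asymptotics) auto
  then have "(\<lambda>N. Z_tail N s * phi powr ((real N + 1) * s) / (q N * C_F)) \<longlonglongrightarrow> K / (H_slope s * C_F)"
    using Dpos K by (intro tendsto_intros q) (auto simp: C)
  moreover have "K / (H_slope s * C_F) = 1"
    using Dpos K by (simp add: C)
  \<comment> \<open>Substituting \<open>Z_tail N s = q N * (s - sigma_N N)\<close> turns the
    convergent quotient into the ratio of the two sides.\<close>
  moreover have "\<forall>\<^sub>F N in sequentially. Z_tail N s * phi powr ((real N + 1) * s) / (q N * C_F)
      = (sigma_F - sigma_N N) / (C_F * phi powr (- (real N + 1) * sigma_F))"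
    using ev
  proof eventually_elim
    case (elim N)
    then have "0 < s - sigma_N N" "0 < Z_tail N s"
      using sigma_N_gap(1)[OF _ s] Z_tail_pos[of s N] s by auto
    moreover have "phi powr (- (real N + 1) * s) = 1 / phi powr ((real N + 1) * s)"
      by (simp only: mult_minus_left powr_minus_divide)
    ultimately show ?case
      by (simp add: q_def sF)
  qed
  ultimately have "(\<lambda>N. (sigma_F - sigma_N N) / (C_F * phi powr (- (real N + 1) * sigma_F))) \<longlonglongrightarrow> 1"
    using Lim_transform_eventually by fastforce
  then show ?thesis
    by (rule asymp_equivI')
qed

section \<open>Numerical values\<close>

lemma encl_state_start: "encl_state s (1, 1, 1, True, (0, 0), (0, 0), (ivl_unit, ivl_unit), (ivl_unit, ivl_unit), (0, 0), (0, 0))"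
  by (simp add: encl_zero encl_one)

lemma encl_state_steps:
  assumes "encl_state s st" "encl si s" "s \<le> 0.7432"
  shows "encl_state s (fib_steps k si st)"
  using assms(1)
proof (induction k arbitrary: st)
  case (Suc k)
  then show ?case
    using Suc.IH[OF encl_state_step[OF Suc.prems assms(2,3)]] by simp
qed simp

text \<open>The denominator is \<open>ivl_unit\<close>, so a degenerate interval represents this
  point exactly.\<close>

definition \<sigma>\<^sub>0 :: real where
  "\<sigma>\<^sub>0 = 219343120340213144188 / 295147905179352825856"

lemma \<sigma>\<^sub>0_bounds: "0.743 < \<sigma>\<^sub>0" "\<sigma>\<^sub>0 \<le> 0.7432"
  by (simp_all add: \<sigma>\<^sub>0_def)

lemma encl_\<sigma>\<^sub>0: "encl (219343120340213144188, 219343120340213144188) \<sigma>\<^sub>0"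
  by (simp add: encl_def ivl_unit_def \<sigma>\<^sub>0_def)

text \<open>The run is interrupted at \<open>n = 5\<close> and \<open>n = 12\<close>, where the values of \<open>5\<^bsup>-\<sigma>\<^esup>\<close>, \<open>144\<^bsup>-\<sigma>\<^esup>\<close> and \<open>ln 144\<close> are read off.\<close>

lemma fib_steps_4:
  "fib_steps 4 (219343120340213144188, 219343120340213144188)
     (1, 1, 1, True, (0, 0), (0, 0), (ivl_unit, ivl_unit), (ivl_unit, ivl_unit), (0, 0), (0, 0)) =
   (5, 5, 8, True, (475022228371155413754, 475022228371155413772),
     (138720586598572057910, 138720586598572057920),
     (89246415299264650991, 89246415299264651011),
     (208135042049670958395, 208135042049670958441),
     (897080390456882499581, 897080390456882499607),
     (265541808004879148916, 265541808004879148951))"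
  by code_simp

lemma fib_steps_7:
  "fib_steps 7 (219343120340213144188, 219343120340213144188)
     (5, 5, 8, True, (475022228371155413754, 475022228371155413772),
       (138720586598572057910, 138720586598572057920),
       (89246415299264650991, 89246415299264651011),
       (208135042049670958395, 208135042049670958441),
       (897080390456882499581, 897080390456882499607),
       (265541808004879148916, 265541808004879148951)) =
   (12, 144, 233, False, (1466829984502344030622, 1466829984502344030752),
     (142032596119671421530, 142032596119671421554),
     (7345539523333422675, 7345539523333422737),
     (206406532577552752679, 206406532577552753182),
     (1170851494359919840624, 1170851494359919840918),
     (929165557186590613032, 929165557186590614015))"
  by code_simp

lemma fib_steps_30:
  "fib_steps 30 (219343120340213144188, 219343120340213144188)
     (12, 144, 233, False, (1466829984502344030622, 1466829984502344030752),
       (142032596119671421530, 142032596119671421554),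
       (7345539523333422675, 7345539523333422737),
       (206406532577552752679, 206406532577552753182),
       (1170851494359919840624, 1170851494359919840918),
       (929165557186590613032, 929165557186590614015)) =
   (42, 267914296, 433494437, False, (5727692694597178940964, 5727692694597178942684),
     (142028662113875159416, 142028662113875159500),
     (160939125190382, 160939125190386),
     (206408577162653581625, 206408577162653583033),
     (1195282164478915155090, 1195282164478915155873),
     (1077919164578931260797, 1077919164578931265816))"
  by code_simp

lemmas encl_state_5 = encl_state_steps[OF encl_state_start encl_\<sigma>\<^sub>0 \<sigma>\<^sub>0_bounds(2), of 4, unfolded fib_steps_4]
lemmas encl_state_12 = encl_state_steps[OF encl_state_5 encl_\<sigma>\<^sub>0 \<sigma>\<^sub>0_bounds(2), of 7, unfolded fib_steps_7]
lemmas encl_state_42 = encl_state_steps[OF encl_state_12 encl_\<sigma>\<^sub>0 \<sigma>\<^sub>0_bounds(2), of 30, unfolded fib_steps_30]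

lemma encl_lower:
  assumes "encl i x" "a * real_of_int ivl_unit \<le> real_of_int (fst i)"
  shows "a \<le> x"
proof -
  have "a * real_of_int ivl_unit \<le> x * real_of_int ivl_unit"
    using assms unfolding encl_def by (auto simp: mult.commute)
  then show ?thesis
    using real_ivl_unit_pos by simp
qed

lemma encl_upper:
  assumes "encl i x" "real_of_int (snd i) \<le> b * real_of_int ivl_unit"
  shows "x \<le> b"
proof -
  have "x * real_of_int ivl_unit \<le> b * real_of_int ivl_unit"
    using assms unfolding encl_def by (auto simp: mult.commute)
  then show ?thesis
    using real_ivl_unit_pos by simp
qed

text \<open>5 is F_5, so its power is part of the state at n = 5. Squaring the claimed decimals
  avoids an interval square root.\<close>

lemma powr_5_bounds: "0.549889640501864402 \<le> 5 powr - (\<sigma>\<^sub>0 / 2)" "5 powr - (\<sigma>\<^sub>0 / 2) \<le> 0.549889640501864404"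
proof -
  have f: "fib 5 = 5"
    by (simp add: eval_nat_numeral)
  have e: "encl (89246415299264650991, 89246415299264651011) (5 powr - \<sigma>\<^sub>0)"
    using encl_state_5 by (simp add: f)
  have sq: "5 powr - \<sigma>\<^sub>0 = (5 powr - (\<sigma>\<^sub>0 / 2))\<^sup>2"
    by (simp add: power2_eq_square flip: powr_add)
  have "0.549889640501864402\<^sup>2 \<le> 5 powr - \<sigma>\<^sub>0" "5 powr - \<sigma>\<^sub>0 \<le> 0.549889640501864404\<^sup>2"
    by (rule encl_lower[OF e] encl_upper[OF e]; simp add: ivl_unit_def power2_eq_square)+
  then show "0.549889640501864402 \<le> 5 powr - (\<sigma>\<^sub>0 / 2)" "5 powr - (\<sigma>\<^sub>0 / 2) \<le> 0.549889640501864404"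
    unfolding sq by (auto dest!: power2_le_imp_le)
qed


lemma fib_12: "fib 12 = 144"
  by (simp add: eval_nat_numeral)

lemma term_144_bounds:
  "0.0248876559664882298 \<le> 144 powr - \<sigma>\<^sub>0" "144 powr - \<sigma>\<^sub>0 \<le> 0.0248876559664882301"
  "4.96981329957600062 \<le> ln (144 :: real)" "ln 144 \<le> (4.96981329957600063 :: real)"
proof -
  have e: "encl (7345539523333422675, 7345539523333422737) (144 powr - \<sigma>\<^sub>0)"
    "encl (1466829984502344030622, 1466829984502344030752) (ln 144)"
    using encl_state_12 by (simp_all add: fib_12)
  show "0.0248876559664882298 \<le> 144 powr - \<sigma>\<^sub>0" "144 powr - \<sigma>\<^sub>0 \<le> 0.0248876559664882301"
    by (rule encl_lower[OF e(1)] encl_upper[OF e(1)]; simp add: ivl_unit_def)+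
  show "4.96981329957600062 \<le> ln (144 :: real)" "ln 144 \<le> (4.96981329957600063 :: real)"
    by (rule encl_lower[OF e(2)] encl_upper[OF e(2)]; simp add: ivl_unit_def)+
qed

lemma fib_42: "fib 42 = 267914296"
  using encl_state_42 by simp

lemma term_42_bounds:
  "0.00000054528296615415 \<le> real (fib 42) powr - \<sigma>\<^sub>0"
  "real (fib 42) powr - \<sigma>\<^sub>0 \<le> 0.00000054528296615417"
  "19.406177696286 \<le> ln (real (fib 42))" "ln (real (fib 42)) \<le> 19.406177696287"
proof -
  have e: "encl (160939125190382, 160939125190386) (real (fib 42) powr - \<sigma>\<^sub>0)"
    "encl (5727692694597178940964, 5727692694597178942684) (ln (real (fib 42)))"
    using encl_state_42 by (simp_all only: encl_state.simps)
  show "0.00000054528296615415 \<le> real (fib 42) powr - \<sigma>\<^sub>0"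
    "real (fib 42) powr - \<sigma>\<^sub>0 \<le> 0.00000054528296615417"
    by (rule encl_lower[OF e(1)] encl_upper[OF e(1)]; simp add: ivl_unit_def)+
  show "19.406177696286 \<le> ln (real (fib 42))" "ln (real (fib 42)) \<le> 19.406177696287"
    by (rule encl_lower[OF e(2)] encl_upper[OF e(2)]; simp add: ivl_unit_def)+
qed

lemma sum_41_bounds:
  "4.0497734983162995311 \<le> (\<Sum>k=1..41. real (fib k) powr - \<sigma>\<^sub>0)"
  "(\<Sum>k=1..41. real (fib k) powr - \<sigma>\<^sub>0) \<le> 4.0497734983162995343"
  "3.65213218750074147 \<le> (\<Sum>k=1..41. ln (fib k) * real (fib k) powr - \<sigma>\<^sub>0)"
  "(\<Sum>k=1..41. ln (fib k) * real (fib k) powr - \<sigma>\<^sub>0) \<le> 3.6521321875007415"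
proof -
  have set: "{1..<42} = {1..41 :: nat}"
    by auto
  have e: "encl (1195282164478915155090, 1195282164478915155873) (\<Sum>k=1..41. real (fib k) powr - \<sigma>\<^sub>0)"
    "encl (1077919164578931260797, 1077919164578931265816)
      (\<Sum>k=1..41. ln (fib k) * real (fib k) powr - \<sigma>\<^sub>0)"
    using encl_state_42 by (simp_all only: encl_state.simps set)
  show "4.0497734983162995311 \<le> (\<Sum>k=1..41. real (fib k) powr - \<sigma>\<^sub>0)"
    "(\<Sum>k=1..41. real (fib k) powr - \<sigma>\<^sub>0) \<le> 4.0497734983162995343"
    by (rule encl_lower[OF e(1)] encl_upper[OF e(1)]; simp add: ivl_unit_def)+
  show "3.65213218750074147 \<le> (\<Sum>k=1..41. ln (fib k) * real (fib k) powr - \<sigma>\<^sub>0)"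
    "(\<Sum>k=1..41. ln (fib k) * real (fib k) powr - \<sigma>\<^sub>0) \<le> 3.6521321875007415"
    by (rule encl_lower[OF e(2)] encl_upper[OF e(2)]; simp add: ivl_unit_def)+
qed

text \<open>The ratio of consecutive Fibonacci numbers \<open>F\<^sub>4\<^sub>3 / F\<^sub>4\<^sub>2\<close> approximates \<^const>\<open>phi\<close> to within
  a factor \<open>1 + 1 / F\<^sub>4\<^sub>2\<^sup>2\<close>, which suffices for the tail of the series.\<close>

lemma phi_bounds:
  "0.699339461810596521 \<le> phi powr - \<sigma>\<^sub>0" "phi powr - \<sigma>\<^sub>0 \<le> 0.699339461810596546"
  "0.4812118250596034 \<le> ln phi" "ln phi \<le> 0.4812118250596035"
proof -
  define \<epsilon> where "\<epsilon> = 1 / real (fib 42) ^ 2"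
  define \<rho> where "\<rho> = real (fib 43) / real (fib 42)"
  define y where "y = \<rho> / phi"
  have Suc: "Suc 42 = 43"
    by simp
  have e: "encl (206408577162653581625, 206408577162653583033) (\<rho> powr - \<sigma>\<^sub>0)"
    "encl (142028662113875159416, 142028662113875159500) (ln \<rho>)"
    using encl_state_42 by (simp_all only: encl_state.simps Suc \<rho>_def)
  have "0 < \<rho>"
    using encl_state_42 by (simp add: \<rho>_def)
  have "\<bar>y - 1\<bar> \<le> \<epsilon>"
    using fib_ratio_bound[of 42 1] by (simp add: y_def \<rho>_def \<epsilon>_def)
  moreover have \<epsilon>: "\<epsilon> = 1 / 71778070001175616"
    by (simp add: \<epsilon>_def fib_42 power2_eq_square)
  ultimately have y: "1 - \<epsilon> \<le> y powr \<sigma>\<^sub>0" "y powr \<sigma>\<^sub>0 \<le> 1 + \<epsilon>" "\<bar>ln y\<bar> \<le> 2 * \<epsilon>"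
    using powr_near_1[of y \<epsilon> \<sigma>\<^sub>0] \<sigma>\<^sub>0_bounds by auto
  have "0.69933946181059653097 \<le> \<rho> powr - \<sigma>\<^sub>0" "\<rho> powr - \<sigma>\<^sub>0 \<le> 0.699339461810596536"
    by (rule encl_lower[OF e(1)] encl_upper[OF e(1)]; simp add: ivl_unit_def)+
  then have "0.69933946181059653097 * (1 - \<epsilon>) \<le> \<rho> powr - \<sigma>\<^sub>0 * y powr \<sigma>\<^sub>0"
    "\<rho> powr - \<sigma>\<^sub>0 * y powr \<sigma>\<^sub>0 \<le> 0.699339461810596536 * (1 + \<epsilon>)"
    using y(1,2) by (intro mult_mono; simp add: \<epsilon>)+
  moreover have "\<rho> powr - \<sigma>\<^sub>0 * y powr \<sigma>\<^sub>0 = phi powr - \<sigma>\<^sub>0"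
    using \<open>0 < \<rho>\<close> phi_gt_1 by (simp add: y_def powr_divide powr_minus_divide)
  ultimately show "0.699339461810596521 \<le> phi powr - \<sigma>\<^sub>0" "phi powr - \<sigma>\<^sub>0 \<le> 0.699339461810596546"
    by (simp_all add: \<epsilon>)
  have "0.481211825059603451 \<le> ln \<rho>" "ln \<rho> \<le> 0.481211825059603452"
    by (rule encl_lower[OF e(2)] encl_upper[OF e(2)]; simp add: ivl_unit_def)+
  moreover have "ln y = ln \<rho> - ln phi"
    unfolding y_def using \<open>0 < \<rho>\<close> phi_gt_1 by (intro ln_divide_pos) auto
  ultimately show "0.4812118250596034 \<le> ln phi" "ln phi \<le> 0.4812118250596035"
    using y(3) by (auto simp: \<epsilon> abs_if split: if_splits)
qed

section \<open>Value and slope of \<open>H\<close>, and the location of its zero\<close>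

lemma H_\<sigma>\<^sub>0: "\<bar>H \<sigma>\<^sub>0\<bar> \<le> 0.000000000000000003"
proof -
  define P x \<epsilon> where "P = real (fib 42) powr - \<sigma>\<^sub>0" and "x = phi powr - \<sigma>\<^sub>0"
    and "\<epsilon> = 1 / real (fib 42) ^ 2"
  have \<epsilon>: "\<epsilon> = 1 / 71778070001175616"
    by (simp add: \<epsilon>_def fib_42 power2_eq_square)
  have P: "0.00000054528296615415 \<le> P" "P \<le> 0.00000054528296615417"
    unfolding P_def by (rule term_42_bounds)+
  have x: "0.699339461810596521 \<le> x" "x \<le> 0.699339461810596546"
    unfolding x_def by (rule phi_bounds)+
  have Suc: "Suc 41 = 42"
    by simp
  have Z_tail: "P / (1 - x) * (1 - \<epsilon>) \<le> Z_tail 41 \<sigma>\<^sub>0" "Z_tail 41 \<sigma>\<^sub>0 \<le> P / (1 - x) * (1 + 2 * \<epsilon>)"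
    using Z_tail_bounds[of 41 \<sigma>\<^sub>0, unfolded Suc] \<sigma>\<^sub>0_bounds by (simp_all add: P_def x_def \<epsilon>_def)
  \<comment> \<open>0.300660538189403454 is 1 minus the upper bound for x; 0.300660538189403479
    below is 1 minus the lower one.\<close>
  have "P / (1 - x) * (1 + 2 * \<epsilon>) \<le> 0.00000054528296615417 / 0.300660538189403454 * (1 + 2 * \<epsilon>)"
    using P x by (intro mult_right_mono frac_le) (auto simp: \<epsilon>)
  also have "\<dots> \<le> 0.0000018136166769271"
    by (simp add: \<epsilon>)
  finally have R_upper: "Z_tail 41 \<sigma>\<^sub>0 \<le> 0.0000018136166769271"
    using Z_tail by linarith
  have "0.0000018136166769269 \<le> 0.00000054528296615415 / 0.300660538189403479 * (1 - \<epsilon>)"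
    by (simp add: \<epsilon>)
  also have "\<dots> \<le> P / (1 - x) * (1 - \<epsilon>)"
    using P x by (intro mult_right_mono frac_le) (auto simp: \<epsilon>)
  finally have R_lower: "0.0000018136166769269 \<le> Z_tail 41 \<sigma>\<^sub>0"
    using Z_tail by linarith
  have "H \<sigma>\<^sub>0 = (\<Sum>k=1..41. real (fib k) powr - \<sigma>\<^sub>0) - 4 - 2 * 144 powr - \<sigma>\<^sub>0 + Z_tail 41 \<sigma>\<^sub>0"
    using H_split[of \<sigma>\<^sub>0 41] \<sigma>\<^sub>0_bounds by (simp add: H_part_def)
  then show ?thesis
    using R_lower R_upper term_144_bounds(1,2) sum_41_bounds(1,2) by (simp add: abs_if)
qed

text \<open>The main term of the tail increases in each of P, L, x and l, so it is bounded by its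
  values at the endpoints of their enclosures.\<close>

lemma H_slope_\<sigma>\<^sub>0: "3.4047954056208476 \<le> H_slope \<sigma>\<^sub>0" "H_slope \<sigma>\<^sub>0 \<le> 3.4047954056208478"
proof -
  define P x \<epsilon> L l where "P = real (fib 42) powr - \<sigma>\<^sub>0" and "x = phi powr - \<sigma>\<^sub>0"
    and "\<epsilon> = 1 / real (fib 42) ^ 2" and "L = ln (real (fib 42))" and "l = ln phi"
  have \<epsilon>: "\<epsilon> = 1 / 71778070001175616"
    by (simp add: \<epsilon>_def fib_42 power2_eq_square)
  have P: "0.00000054528296615415 \<le> P" "P \<le> 0.00000054528296615417"
    unfolding P_def by (rule term_42_bounds)+
  have L: "19.406177696286 \<le> L" "L \<le> 19.406177696287"
    unfolding L_def by (rule term_42_bounds)+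
  have x: "0.699339461810596521 \<le> x" "x \<le> 0.699339461810596546"
    unfolding x_def by (rule phi_bounds)+
  have l: "0.4812118250596034 \<le> l" "l \<le> 0.4812118250596035"
    unfolding l_def by (rule phi_bounds)+
  have Suc: "Suc 41 = 42"
    by simp
  define E where "E = P * (L / (1 - x) + l * x / (1 - x)\<^sup>2)"
  have T: "E * (1 - 3 * \<epsilon>) \<le> H_slope \<sigma>\<^sub>0 - H_part_slope 41 \<sigma>\<^sub>0" "H_slope \<sigma>\<^sub>0 - H_part_slope 41 \<sigma>\<^sub>0 \<le> E * (1 + 6 * \<epsilon>)"
    using H_slope_tail_bounds[of 41 \<sigma>\<^sub>0, unfolded Suc] \<sigma>\<^sub>0_bounds
    by (simp_all add: E_def P_def x_def \<epsilon>_def L_def l_def)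
  have "E \<le> 0.00000054528296615417 * (19.406177696287 / 0.300660538189403454
      + 0.4812118250596035 * 0.699339461810596546 / 0.300660538189403454\<^sup>2)"
    unfolding E_def using P L x l
    by (intro mult_mono add_mono frac_le power_mono add_nonneg_nonneg divide_nonneg_nonneg mult_nonneg_nonneg) auto
  then have "E * (1 + 6 * \<epsilon>) \<le> 0.00000054528296615417 * (19.406177696287 / 0.300660538189403454
      + 0.4812118250596035 * 0.699339461810596546 / 0.300660538189403454\<^sup>2) * (1 + 6 * \<epsilon>)"
    by (rule mult_right_mono) (simp add: \<epsilon>)
  also have "\<dots> \<le> 0.0000372253551567"
    by (simp add: \<epsilon> power2_eq_square)
  finally have T_upper: "H_slope \<sigma>\<^sub>0 - H_part_slope 41 \<sigma>\<^sub>0 \<le> 0.0000372253551567"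
    using T by simp
  have "0.00000054528296615415 * (19.406177696286 / 0.300660538189403479
      + 0.4812118250596034 * 0.699339461810596521 / 0.300660538189403479\<^sup>2) \<le> E"
    unfolding E_def using P L x l
    by (intro mult_mono add_mono frac_le power_mono add_nonneg_nonneg divide_nonneg_nonneg mult_nonneg_nonneg) auto
  then have "0.00000054528296615415 * (19.406177696286 / 0.300660538189403479
      + 0.4812118250596034 * 0.699339461810596521 / 0.300660538189403479\<^sup>2) * (1 - 3 * \<epsilon>) \<le> E * (1 - 3 * \<epsilon>)"
    by (rule mult_right_mono) (simp add: \<epsilon>)
  moreover have "0.0000372253551566 \<le> 0.00000054528296615415 * (19.406177696286 / 0.300660538189403479
      + 0.4812118250596034 * 0.699339461810596521 / 0.300660538189403479\<^sup>2) * (1 - 3 * \<epsilon>)"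
    by (simp add: \<epsilon> power2_eq_square)
  ultimately have T_lower: "0.0000372253551566 \<le> H_slope \<sigma>\<^sub>0 - H_part_slope 41 \<sigma>\<^sub>0"
    using T by linarith
  have "4.96981329957600062 * 0.0248876559664882298 \<le> ln 144 * 144 powr - \<sigma>\<^sub>0"
    "ln 144 * 144 powr - \<sigma>\<^sub>0 \<le> 4.96981329957600063 * 0.0248876559664882301"
    using term_144_bounds by (intro mult_mono; simp)+
  then show "3.4047954056208476 \<le> H_slope \<sigma>\<^sub>0" "H_slope \<sigma>\<^sub>0 \<le> 3.4047954056208478"
    using T_lower T_upper sum_41_bounds(3,4) by (simp_all add: H_part_slope_def)
qed

text \<open>With slope at least 3, moving by \<delta> = 2e-18 changes \<open>H\<close> by at least
  6e-18, more than its value at the centre; hence a sign change and a zero.\<close>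

lemma root_bounds:
  obtains s where "H s = 0" "\<bar>s - \<sigma>\<^sub>0\<bar> \<le> 0.000000000000000002"
proof -
  define \<delta> :: real where "\<delta> = 0.000000000000000002"
  \<comment> \<open>The Lipschitz constant 900 lets the slope move by at most 1.8e-15 from its value
    near 3.4.\<close>
  have H_slope: "3 \<le> H_slope s" if "\<bar>s - \<sigma>\<^sub>0\<bar> \<le> \<delta>" for s
  proof -
    have "1 / 2 \<le> s" "1 / 2 \<le> \<sigma>\<^sub>0"
      using that \<sigma>\<^sub>0_bounds by (auto simp: \<delta>_def abs_if split: if_splits)
    then show ?thesis
      using H_slope_lipschitz[of s \<sigma>\<^sub>0] H_slope_\<sigma>\<^sub>0(1) that by (auto simp: \<delta>_def abs_if split: if_splits)
  qed
  have deriv: "(H has_real_derivative - H_slope s) (at s)" if "\<bar>s - \<sigma>\<^sub>0\<bar> \<le> \<delta>" for s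
    using \<sigma>\<^sub>0_bounds that by (intro H_deriv) (auto simp: \<delta>_def abs_if split: if_splits)
  obtain t where t: "\<sigma>\<^sub>0 - \<delta> < t" "t < \<sigma>\<^sub>0" "H \<sigma>\<^sub>0 - H (\<sigma>\<^sub>0 - \<delta>) = (\<sigma>\<^sub>0 - (\<sigma>\<^sub>0 - \<delta>)) * - H_slope t"
    using MVT2[of "\<sigma>\<^sub>0 - \<delta>" \<sigma>\<^sub>0 H "\<lambda>x. - H_slope x"] deriv by (auto simp: \<delta>_def)
  obtain u where u: "\<sigma>\<^sub>0 < u" "u < \<sigma>\<^sub>0 + \<delta>" "H (\<sigma>\<^sub>0 + \<delta>) - H \<sigma>\<^sub>0 = (\<sigma>\<^sub>0 + \<delta> - \<sigma>\<^sub>0) * - H_slope u"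
    using MVT2[of \<sigma>\<^sub>0 "\<sigma>\<^sub>0 + \<delta>" H "\<lambda>x. - H_slope x"] deriv by (auto simp: \<delta>_def)
  have "3 * \<delta> \<le> \<delta> * H_slope t" "3 * \<delta> \<le> \<delta> * H_slope u"
    using H_slope[of t] H_slope[of u] t u by (simp_all add: \<delta>_def)
  then have "0 \<le> H (\<sigma>\<^sub>0 - \<delta>)" "H (\<sigma>\<^sub>0 + \<delta>) \<le> 0"
    using t(3) u(3) H_\<sigma>\<^sub>0 by (simp_all add: \<delta>_def abs_le_iff)
  moreover have "\<forall>x. \<sigma>\<^sub>0 - \<delta> \<le> x \<and> x \<le> \<sigma>\<^sub>0 + \<delta> \<longrightarrow> isCont H x"
    using deriv by (auto intro!: DERIV_isCont[OF deriv])
  ultimately obtain s where "\<sigma>\<^sub>0 - \<delta> \<le> s" "s \<le> \<sigma>\<^sub>0 + \<delta>" "H s = 0"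
    using IVT2[of H "\<sigma>\<^sub>0 + \<delta>" 0 "\<sigma>\<^sub>0 - \<delta>"] by (auto simp: \<delta>_def)
  then show ?thesis
    by (intro that[of s]) (auto simp: \<delta>_def abs_if)
qed

section \<open>Transfer from the nearby point to the zero, and the digits of
  \<open>C_F\<close>\<close>

lemma powr_lipschitz:
  fixes c s t :: real
  assumes "1 \<le> c" "0 \<le> s" "0 \<le> t"
  shows "\<bar>c powr - s - c powr - t\<bar> \<le> ln c * \<bar>s - t\<bar>"
proof -
  have "norm (c powr - s - c powr - t) \<le> ln c * norm (s - t)"
  proof (rule field_differentiable_bound)
    show "convex {0 :: real..}"
      by (rule convex_real_interval)
    show "((\<lambda>s. c powr - s) has_field_derivative - (ln c * c powr - x)) (at x within {0..})" for x
      using assms(1) by (intro DERIV_powr_minus) simp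
    show "norm (- (ln c * c powr - x)) \<le> ln c" if "x \<in> {0..}" for x
      using that assms(1) powr_mono[of "- x" 0 c] by (simp add: abs_mult mult_left_le)
  qed (use assms in auto)
  then show ?thesis
    by simp
qed

theorem corollary8p2:
  shows "(\<lambda>N. sigma_F - sigma_N N) \<sim>[sequentially]
           (\<lambda>N. C_F * phi powr (- (real N + 1) * sigma_F))
         \<and> 1.77646645548344 \<le> C_F \<and> C_F < 1.77646645548345"
proof -
  obtain s where s: "H s = 0" "\<bar>s - \<sigma>\<^sub>0\<bar> \<le> 0.000000000000000002"
    by (rule root_bounds)
  have s7: "0.7 < s" "s < 0.75"
    using s(2) \<sigma>\<^sub>0_bounds by (auto simp: abs_if split: if_splits)
  have sF: "sigma_F = s"
    using s7 s(1) by (rule sigma_F_eqI)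
  define y x where "y = 5 powr - (s / 2)" and "x = phi powr - s"
  \<comment> \<open>The enclosure at the nearby point, widened by 900 * 2e-18 on each side.\<close>
  have H_slope: "3.4047954056208458 \<le> H_slope s" "H_slope s \<le> 3.4047954056208496"
    using H_slope_lipschitz[of s \<sigma>\<^sub>0] H_slope_\<sigma>\<^sub>0 s(2) s7 \<sigma>\<^sub>0_bounds by (auto simp: abs_if split: if_splits)
  have "ln phi \<le> 1"
    using phi_bounds(4) by simp
  have "\<bar>x - phi powr - \<sigma>\<^sub>0\<bar> \<le> ln phi * \<bar>s - \<sigma>\<^sub>0\<bar>"
    unfolding x_def using phi_gt_1 s7 \<sigma>\<^sub>0_bounds by (intro powr_lipschitz) auto
  also have "\<dots> \<le> 1 * 0.000000000000000002"
    using \<open>ln phi \<le> 1\<close> s(2) by (intro mult_mono) auto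
  finally have x: "0.699339461810596519 \<le> x" "x \<le> 0.699339461810596548"
    using phi_bounds by (auto simp: abs_if split: if_splits)
  have "ln (5 :: real) \<le> ln (2 ^ 3)"
    by simp
  also have "\<dots> = 3 * ln 2"
    by (subst ln_realpow) auto
  finally have "ln (5 :: real) \<le> 3"
    using ln2_le_25_over_36 by simp
  have "\<bar>y - 5 powr - (\<sigma>\<^sub>0 / 2)\<bar> \<le> ln 5 * \<bar>s / 2 - \<sigma>\<^sub>0 / 2\<bar>"
    unfolding y_def using s7 \<sigma>\<^sub>0_bounds by (intro powr_lipschitz) auto
  also have "\<dots> \<le> 3 * 0.000000000000000001"
    using \<open>ln 5 \<le> 3\<close> s(2) by (intro mult_mono) (auto simp: abs_if split: if_splits)
  finally have y: "0.549889640501864399 \<le> y" "y \<le> 0.549889640501864407"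
    using powr_5_bounds by (auto simp: abs_if split: if_splits)
  \<comment> \<open>Written as the reciprocal of a product of three positive enclosed factors, so
    that only that product needs bounds. Those of 1 - x are the complements of the bounds on
    x.\<close>
  have C: "C_F = 1 / (y * H_slope s * (1 - x))"
    using C_F_eq s7 by (simp add: sF x_def y_def powr_minus_divide)
  have upper: "y * H_slope s * (1 - x) \<le> 0.549889640501864407 * 3.4047954056208496 * 0.300660538189403481"
    using x y H_slope by (intro mult_mono) auto
  have lower: "0.549889640501864399 * 3.4047954056208458 * 0.300660538189403452 \<le> y * H_slope s * (1 - x)"
    using x y H_slope by (intro mult_mono) auto
  have "1.77646645548344 \<le> 1 / (0.549889640501864407 * 3.4047954056208496 * 0.300660538189403481 :: real)"
    by simp
  also have "\<dots> \<le> C_F"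
    unfolding C using lower by (intro divide_left_mono upper) (auto intro!: mult_pos_pos)
  finally have 1: "1.77646645548344 \<le> C_F" .
  have "C_F \<le> 1 / (0.549889640501864399 * 3.4047954056208458 * 0.300660538189403452)"
    unfolding C using lower by (intro divide_left_mono lower) (auto intro!: mult_pos_pos)
  also have "\<dots> < 1.77646645548345"
    by simp
  finally show ?thesis
    using 1 sigma_gap_asymptotics[OF s7 s(1)] by blast
qed

end
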